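(* There is an absolute constant $C>0$ such that the following holds. For every positive integer $n$ and every real number $\varepsilon\in(0,3]$, there is a deterministic online algorithm for the online sorting problem with $n$ numbers and an array of size $(1+\varepsilon)n$ whose competitive ratio is at most $\left(\varepsilon^{-1}\log n\right)^{C\log\log n}$, i.e. it is $\left(\varepsilon^{-1}\log n\right)^{O(\log\log n)}$.
   Context: Online sorting problem: $n$ real numbers $x_1,\dots,x_n$ arrive one at a time. Upon the arrival of each number, before seeing the next one, the algorithm must irrevocably place it into an empty cell of an array $A$ with $(1+\varepsilon)n$ cells (indexed from $1$; each cell holds at most one number). After all $n$ numbers are placed, let $i_1<i_2<\dots<i_n$ be the indices of the nonempty cells; the cost is $\sum_{k=1}^{n-1}|A[i_k]-A[i_{k+1}]|$ (empty cells are ignored). The optimal offline cost (placing the numbers in sorted order) equals $\max_i x_i-\min_i x_i$. The competitive ratio of an online algorithm is the supremum, over input sequences of $n$ numbers, of its cost divided by the optimal offline cost. Equivalently (the normalization used), one may assume the inputs lie in $[0,1]$ and include both $0$ and $1$, so the optimal cost is $1$ and the competitive ratio equals the worst-case cost. The asymptotic notation is as $n\to\infty$, with the implied constant independent of $n$ and $\varepsilon$.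
   Formalization: Logarithms are base 2; the stated bound is proved for n ≥ 9, and for n ≤ 8 the ratio is only bounded by the absolute constant C, since the stated bound fails for small n (for n = 3, ε = 3 it is below 1; for n = 1 log log n is undefined). *)

theory Defs
  imports Complex_Main "HOL-Library.Multiset" "HOL-Library.Extended_Real"
begin

type_synonym cells = "nat \<rightharpoonup> real"

definition contents :: "cells \<Rightarrow> real list" where
  "contents a = map (\<lambda>i. the (a i)) (sorted_list_of_set (dom a))"

definition array_cost :: "cells \<Rightarrow> real" where
  "array_cost a =
     (\<Sum>k<length (contents a) - 1. \<bar>contents a ! k - contents a ! Suc k\<bar>)"

text \<open>
  A deterministic online algorithm maps the numbers seen so far, the newly arrived one being
  the last, to the index of the cell that receives the new number. Earlier placements need not
  be an argument, since they are determined by the earlier numbers.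
\<close>

type_synonym online_alg = "real list \<Rightarrow> nat"

primrec array_after :: "online_alg \<Rightarrow> real list \<Rightarrow> nat \<Rightarrow> cells" where
  "array_after A xs 0 = Map.empty"
| "array_after A xs (Suc k) = (array_after A xs k)(A (take (Suc k) xs) \<mapsto> xs ! k)"

definition online_sorting_algorithm :: "nat \<Rightarrow> nat \<Rightarrow> online_alg \<Rightarrow> bool" where
  "online_sorting_algorithm n m A \<longleftrightarrow>
     (\<forall>xs. length xs = n \<longrightarrow>
       (\<forall>k<n. A (take (Suc k) xs) \<in> {1..m} \<and>
              array_after A xs k (A (take (Suc k) xs)) = None))"

definition online_cost :: "online_alg \<Rightarrow> real list \<Rightarrow> real" where
  "online_cost A xs = array_cost (array_after A xs (length xs))"

definition offline_placements :: "nat \<Rightarrow> real list \<Rightarrow> cells set" where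
  "offline_placements m xs = {a. dom a \<subseteq> {1..m} \<and> mset (contents a) = mset xs}"

definition opt_cost :: "nat \<Rightarrow> real list \<Rightarrow> real" where
  "opt_cost m xs = (INF a \<in> offline_placements m xs. array_cost a)"

text \<open>
  If the optimum is 0, all input numbers are equal and the online cost is 0 too; such inputs
  contribute the quotient 0 / 0 = 0, so they do not affect the supremum. The supremum is taken
  in the extended reals, where it is meaningful without any boundedness requirement.
\<close>

definition competitive_ratio :: "nat \<Rightarrow> nat \<Rightarrow> online_alg \<Rightarrow> ereal" where
  "competitive_ratio n m A =
     (SUP xs \<in> {xs. length xs = n}. ereal (online_cost A xs / opt_cost m xs))"

text \<open>
  For non-integral \<open>(1 + \<epsilon>) n\<close> the number of cells is rounded down, the more demanding choice.
\<close>

definition array_size :: "nat \<Rightarrow> real \<Rightarrow> nat" where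
  "array_size n \<epsilon> = nat \<lfloor>(1 + \<epsilon>) * real n\<rfloor>"

lemma abs_diff_le_path:
  fixes ys :: "real list"
  assumes "i \<le> j" "j < length ys"
  shows "\<bar>ys ! i - ys ! j\<bar> \<le> (\<Sum>k=i..<j. \<bar>ys ! k - ys ! Suc k\<bar>)"
  using assms
proof (induction rule: dec_induct)
  case base
  then show ?case by simp
next
  case (step j)
  have "\<bar>ys ! i - ys ! Suc j\<bar> \<le> \<bar>ys ! i - ys ! j\<bar> + \<bar>ys ! j - ys ! Suc j\<bar>" by linarith
  with step show ?case by simp
qed

lemma range_le_path:
  fixes ys :: "real list"
  assumes "ys \<noteq> []"
  shows "Max (set ys) - Min (set ys) \<le> (\<Sum>k<length ys - 1. \<bar>ys ! k - ys ! Suc k\<bar>)"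
proof -
  have "Max (set ys) \<in> set ys" "Min (set ys) \<in> set ys" using assms by simp_all
  then obtain i j where ij: "i < length ys" "j < length ys"
    "ys ! i = Max (set ys)" "ys ! j = Min (set ys)"
    by (metis in_set_conv_nth)
  let ?p = "min i j" and ?q = "max i j"
  have "Max (set ys) - Min (set ys) \<le> \<bar>ys ! ?p - ys ! ?q\<bar>"
    using ij by (auto simp: min_def max_def)
  also have "\<dots> \<le> (\<Sum>k=?p..<?q. \<bar>ys ! k - ys ! Suc k\<bar>)"
    by (rule abs_diff_le_path) (use ij in auto)
  also have "\<dots> \<le> (\<Sum>k<length ys - 1. \<bar>ys ! k - ys ! Suc k\<bar>)"
    by (rule sum_mono2) (use ij in auto)
  finally show ?thesis .
qed

lemma sorted_path:
  fixes ys :: "real list"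
  assumes "sorted ys" "ys \<noteq> []"
  shows "(\<Sum>k<length ys - 1. \<bar>ys ! k - ys ! Suc k\<bar>) = Max (set ys) - Min (set ys)"
proof -
  let ?l = "length ys - 1"
  have "(\<Sum>k<?l. \<bar>ys ! k - ys ! Suc k\<bar>) = (\<Sum>k<?l. ys ! Suc k - ys ! k)"
  proof (rule sum.cong)
    fix k assume "k \<in> {..<?l}"
    then have "ys ! k \<le> ys ! Suc k" using assms by (intro sorted_nth_mono) auto
    then show "\<bar>ys ! k - ys ! Suc k\<bar> = ys ! Suc k - ys ! k" by simp
  qed simp
  also have "\<dots> = ys ! ?l - ys ! 0" by (rule sum_lessThan_telescope)
  also have "ys ! ?l = Max (set ys)"
  proof (rule Max_eqI[symmetric])
    fix y assume "y \<in> set ys"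
    then obtain i where "i < length ys" "y = ys ! i" by (auto simp: in_set_conv_nth)
    then show "y \<le> ys ! ?l" using assms by (auto intro!: sorted_nth_mono)
  qed (use assms in simp_all)
  also have "ys ! 0 = Min (set ys)"
  proof (rule Min_eqI[symmetric])
    fix y assume "y \<in> set ys"
    then obtain i where "i < length ys" "y = ys ! i" by (auto simp: in_set_conv_nth)
    then show "ys ! 0 \<le> y" using assms by (auto intro!: sorted_nth_mono)
  qed (use assms in simp_all)
  finally show ?thesis .
qed

lemma opt_cost_eq:
  assumes "xs \<noteq> []" "length xs \<le> m"
  shows "opt_cost m xs = Max (set xs) - Min (set xs)"
proof -
  let ?r = "Max (set xs) - Min (set xs)"
  have lower: "?r \<le> array_cost a" if "a \<in> offline_placements m xs" for a
  proof -
    from that have ms: "mset (contents a) = mset xs" by (simp add: offline_placements_def)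
    then have "set (contents a) = set xs" by (rule mset_eq_setD)
    moreover from this assms have "contents a \<noteq> []" by auto
    ultimately show ?thesis using range_le_path[of "contents a"] by (simp add: array_cost_def)
  qed
  define ys where "ys = sort xs"
  define a where "a = (\<lambda>i. if i \<in> {1..length ys} then Some (ys ! (i - 1)) else None)"
  have dom: "dom a = {1..length ys}" by (auto simp: a_def dom_def split: if_splits)
  have sl: "sorted_list_of_set (dom a) = [1..<Suc (length ys)]"
    unfolding dom by (metis atLeastLessThanSuc_atLeastAtMost sorted_list_of_set_range)
  have c: "contents a = ys"
    unfolding contents_def sl by (rule nth_equalityI) (auto simp: a_def simp del: upt_Suc)
  have "a \<in> offline_placements m xs"
    using assms c dom by (simp add: offline_placements_def ys_def)
  moreover have "array_cost a = ?r"
    unfolding array_cost_def c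
    using sorted_path[of ys] assms by (simp add: ys_def) (metis length_0_conv length_sort)
  ultimately show ?thesis
    unfolding opt_cost_def using lower by (intro cInf_eq_minimum) force+
qed

text \<open>
  For logarithms to base 2, the numbers \<open>n \<ge> 9\<close> are exactly those with \<open>log n > 3\<close>, that is, those
  for which \<open>(inverse \<epsilon> * log n) powr (C * log (log n)) > 1\<close> for every \<open>\<epsilon>\<close> in \<open>(0,3]\<close>. For
  smaller \<open>n\<close> this expression can be at most 1 (or less than 1, which no algorithm achieves for
  \<open>n \<ge> 2\<close>), and an asymptotic bound as \<open>n\<close> tends to infinity only asks for a ratio bounded by an
  absolute constant there.
\<close>

end

theory Submission
  imports Defs "HOL-Library.Discrete_Functions"
begin

text \<open>
  For numbers in a known interval, cut the array into about \<open>\<surd>m\<close> blocks of \<open>\<surd>m\<close> cells and the interval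
  into \<open>d\<close> subintervals, where \<open>d\<close> is a small fraction of \<open>\<surd>m\<close>. Each subinterval fills one block at a
  time, so only \<open>d\<close> blocks stay partly empty. Where to put a new block is again an online sorting
  problem, on \<open>\<surd>m\<close> cells, and so is filling a block, at a cost scaled by \<open>1/d\<close>. Hence the cost grows
  by a factor polynomial in \<open>log n / \<epsilon>\<close> in each of the \<open>log log n\<close> levels of the recursion. An unknown
  range is guessed, and the guess at least doubles when it fails; the numbers arriving under one
  guess are stored in consecutive chunks of geometrically growing size, which costs
  another polylogarithmic factor and wastes little space.
\<close>

text \<open>Wasted space fixes the parameters. If the games on sqrt m cells waste a fraction \<eta>,
  then the order of the blocks and the filling of the blocks waste \<eta> each, while the d partly
  empty blocks and all roundings add O(\<delta>), where \<delta> is about d / sqrt m. So the waste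
  roughly doubles per level and is of order 2^r \<delta> after r levels. About log log n levels are
  needed until any placement is affordable, and then 2^r is of order log n. Keeping the waste below
  \<epsilon> forces \<delta> to be of order \<epsilon> / log n. Since a level multiplies the cost by
  about sqrt m / d, that is 1 / \<delta>, this is the origin of the base log n / \<epsilon>.\<close>

definition var :: "(nat \<Rightarrow> real) \<Rightarrow> nat \<Rightarrow> nat \<Rightarrow> real" where
  "var g u v = (\<Sum>i=u..<v. \<bar>g i - g (Suc i)\<bar>)"

lemma var_nonneg: "0 \<le> var g u v"
  by (simp add: var_def sum_nonneg)

lemma var_split: "u \<le> v \<Longrightarrow> v \<le> w \<Longrightarrow> var g u w = var g u v + var g v w"
  by (simp add: var_def sum.atLeastLessThan_concat)

lemma var_Suc: "u \<le> v \<Longrightarrow> var g u (Suc v) = var g u v + \<bar>g v - g (Suc v)\<bar>"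
  by (simp add: var_def)

lemma var_cong: "(\<And>i. u \<le> i \<Longrightarrow> i \<le> v \<Longrightarrow> g i = h i) \<Longrightarrow> var g u v = var h u v"
  by (auto simp: var_def intro!: sum.cong)

lemma abs_diff_le_var: "u \<le> v \<Longrightarrow> \<bar>g u - g v\<bar> \<le> var g u v"
  by (induction rule: dec_induct) (auto simp: var_Suc var_nonneg)

lemma var_mono:
  assumes "u \<le> v" "v \<le> w" "w \<le> z"
  shows "var g v w \<le> var g u z"
  using var_split[of u v w g] var_split[of u w z g] var_nonneg[of g u v] var_nonneg[of g w z] assms
  by linarith

text \<open>The triangle inequality bounds each jump between neighbouring nonempty cells by the
  variation of \<open>g\<close> between them, and these stretches are disjoint. The variation over
  the cells \<open>u..<v\<close> also contains the step to \<open>g v\<close>, which makes it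
  exactly additive over adjacent ranges.\<close>

lemma array_cost_le_var:
  assumes dom: "dom a \<subseteq> {u..<v}" and ext: "\<And>i x. a i = Some x \<Longrightarrow> g i = x"
  shows "array_cost a \<le> var g u v"
proof -
  define l where "l = sorted_list_of_set (dom a)"
  have fin: "finite (dom a)" using dom finite_subset by blast
  have setl: "set l = dom a" using fin by (simp add: l_def)
  have sorted: "sorted l" by (simp add: l_def)
  have c: "contents a ! k = g (l ! k)" if "k < length l" for k
  proof -
    have "l ! k \<in> dom a" using that setl nth_mem by blast
    then show ?thesis using that ext by (auto simp: contents_def l_def[symmetric])
  qed
  have len: "length (contents a) = length l" by (simp add: contents_def l_def)
  have le: "l ! k \<le> l ! Suc k" if "Suc k < length l" for k
    using sorted that by (simp add: sorted_nth_mono)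
  have part: "(\<Sum>k<j. \<bar>g (l ! k) - g (l ! Suc k)\<bar>) \<le> var g (l ! 0) (l ! j)"
    if "j < length l" for j
    using that
  proof (induction j)
    case 0
    then show ?case by (simp add: var_nonneg)
  next
    case (Suc j)
    have "l ! 0 \<le> l ! j" using sorted Suc.prems by (simp add: sorted_nth_mono)
    then show ?case
      using Suc abs_diff_le_var[OF le, of j g] var_split[of "l ! 0" "l ! j" "l ! Suc j" g] le[of j]
      by simp
  qed
  show ?thesis
  proof (cases "l = []")
    case True
    then show ?thesis by (simp add: array_cost_def len var_nonneg)
  next
    case False
    then have lt: "length l - 1 < length l" by simp
    have "array_cost a = (\<Sum>k<length l - 1. \<bar>g (l ! k) - g (l ! Suc k)\<bar>)"
      unfolding array_cost_def len by (intro sum.cong) (auto simp: c)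
    also have "\<dots> \<le> var g (l ! 0) (l ! (length l - 1))" by (rule part[OF lt])
    also have "\<dots> \<le> var g u v"
    proof (rule var_mono)
      have "l ! 0 \<in> dom a" "l ! (length l - 1) \<in> dom a"
        using False setl lt nth_mem by (metis length_greater_0_conv)+
      then show "u \<le> l ! 0" "l ! (length l - 1) \<le> v" using dom by auto
      show "l ! 0 \<le> l ! (length l - 1)" using sorted False by (simp add: sorted_nth_mono)
    qed
    finally show ?thesis .
  qed
qed

section \<open>The placement game and online algorithms\<close>

text \<open>The test \<open>ok\<close> applies at every position, not just at the end: blocks and
  chunks may stay partly full, and their cost must be under control then. The alternating
  quantifiers replace an explicit algorithm, so that strategies can be combined by invariants
  alone.\<close>

primrec win :: "(cells \<Rightarrow> bool) \<Rightarrow> nat set \<Rightarrow> real set \<Rightarrow> nat \<Rightarrow> cells \<Rightarrow> bool" where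
  "win ok P X 0 a \<longleftrightarrow> ok a"
| "win ok P X (Suc N) a \<longleftrightarrow>
     ok a \<and> (\<forall>x\<in>X. \<exists>p\<in>P. a p = None \<and> win ok P X N (a(p \<mapsto> x)))"

lemma win_ok: "win ok P X N a \<Longrightarrow> ok a"
  by (cases N) auto

lemma win_SucE:
  assumes "win ok P X (Suc N) a" "x \<in> X"
  obtains p where "p \<in> P" "a p = None" "win ok P X N (a(p \<mapsto> x))"
  using assms by auto

definition pick :: "(cells \<Rightarrow> bool) \<Rightarrow> nat set \<Rightarrow> real set \<Rightarrow> nat \<Rightarrow> cells \<Rightarrow> real \<Rightarrow> nat" where
  "pick ok P X N a x = (SOME p. p \<in> P \<and> a p = None \<and> win ok P X N (a(p \<mapsto> x)))"

lemma pick: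
  assumes "win ok P X (Suc N) a" "x \<in> X"
  shows "pick ok P X N a x \<in> P" "a (pick ok P X N a x) = None"
    "win ok P X N (a(pick ok P X N a x \<mapsto> x))"
proof -
  have "\<exists>p. p \<in> P \<and> a p = None \<and> win ok P X N (a(p \<mapsto> x))" by (rule win_SucE[OF assms]) blast
  from someI_ex[OF this]
  show "pick ok P X N a x \<in> P" "a (pick ok P X N a x) = None"
    "win ok P X N (a(pick ok P X N a x \<mapsto> x))"
    unfolding pick_def by blast+
qed

text \<open>The history is stored with the most recent number first.\<close>

primrec state :: "(cells \<Rightarrow> bool) \<Rightarrow> nat set \<Rightarrow> nat \<Rightarrow> real list \<Rightarrow> cells" where
  "state ok P n [] = Map.empty"
| "state ok P n (x # h) =
     (state ok P n h)(pick ok P UNIV (n - Suc (length h)) (state ok P n h) x \<mapsto> x)"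

text \<open>An online algorithm sees only the numbers so far, so the array before the last move is
  recomputed from them; \<open>n - length xs\<close> moves remain after this one.\<close>

definition strategy :: "(cells \<Rightarrow> bool) \<Rightarrow> nat set \<Rightarrow> nat \<Rightarrow> online_alg" where
  "strategy ok P n xs = pick ok P UNIV (n - length xs) (state ok P n (rev (butlast xs))) (last xs)"

lemma strategy_state:
  assumes "win ok P UNIV n Map.empty" "length xs = n" "k \<le> n"
  shows "array_after (strategy ok P n) xs k = state ok P n (rev (take k xs)) \<and>
    win ok P UNIV (n - k) (state ok P n (rev (take k xs)))"
  using assms(3)
proof (induction k)
  case 0
  then show ?case using assms(1) by simp
next
  case (Suc k)
  then have t: "take (Suc k) xs = take k xs @ [xs ! k]"
    using assms(2) by (simp add: take_Suc_conv_app_nth)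
  have "n - k = Suc (n - Suc k)" using Suc.prems by simp
  then have w: "win ok P UNIV (Suc (n - Suc k)) (state ok P n (rev (take k xs)))"
    using Suc by simp
  have "butlast (take (Suc k) xs) = take k xs" "last (take (Suc k) xs) = xs ! k"
    unfolding t by simp_all
  then show ?case
    using Suc pick(3)[OF w, of "xs ! k"] assms(2)
    by (simp add: t strategy_def min_def fun_upd_def del: win.simps)
qed

lemma online_sorting_algorithm_strategy:
  assumes "win ok {1..m} UNIV n Map.empty"
  shows "online_sorting_algorithm n m (strategy ok {1..m} n)"
  unfolding online_sorting_algorithm_def
proof (intro allI impI)
  fix xs :: "real list" and k assume len: "length xs = n" and k: "k < n"
  have t: "take (Suc k) xs = take k xs @ [xs ! k]"
    using len k by (simp add: take_Suc_conv_app_nth)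
  have "n - k = Suc (n - Suc k)" using k by simp
  then have w: "win ok {1..m} UNIV (Suc (n - Suc k)) (state ok {1..m} n (rev (take k xs)))"
    and s: "array_after (strategy ok {1..m} n) xs k = state ok {1..m} n (rev (take k xs))"
    using strategy_state[OF assms len, of k] k by simp_all
  have "strategy ok {1..m} n (take (Suc k) xs) =
      pick ok {1..m} UNIV (n - Suc k) (state ok {1..m} n (rev (take k xs))) (xs ! k)"
    using len k by (simp add: strategy_def t min_def)
  then show "strategy ok {1..m} n (take (Suc k) xs) \<in> {1..m} \<and>
      array_after (strategy ok {1..m} n) xs k (strategy ok {1..m} n (take (Suc k) xs)) = None"
    using pick(1,2)[OF w] s by simp
qed

lemma ok_strategy:
  assumes "win ok P UNIV n Map.empty" "length xs = n"
  shows "ok (array_after (strategy ok P n) xs n)"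
  using strategy_state[OF assms, of n] by simp

lemma ran_array_after: "k \<le> length xs \<Longrightarrow> ran (array_after A xs k) \<subseteq> set xs"
proof (induction k)
  case (Suc k)
  then have "xs ! k \<in> set xs" by simp
  with Suc show ?case by (auto simp: ran_def split: if_splits)
qed simp

text \<open>Applied to the tightest interval, the hypothesis compares the cost with the optimum
  itself; if that is 0, the quotient is 0 by the convention for division.\<close>

lemma competitive_ratio_le:
  assumes ok: "\<And>xs l h. length xs = n \<Longrightarrow> l \<le> h \<Longrightarrow> set xs \<subseteq> {l..h} \<Longrightarrow>
      online_cost A xs \<le> \<rho> * (h - l)"
    and "1 \<le> n" "n \<le> m" "0 \<le> \<rho>"
  shows "competitive_ratio n m A \<le> ereal \<rho>"
  unfolding competitive_ratio_def
proof (rule SUP_least)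
  fix xs :: "real list" assume "xs \<in> {xs. length xs = n}"
  then have len: "length xs = n" by simp
  then have ne: "xs \<noteq> []" using \<open>1 \<le> n\<close> by auto
  let ?l = "Min (set xs)" and ?h = "Max (set xs)"
  have opt: "opt_cost m xs = ?h - ?l" using opt_cost_eq[OF ne] len \<open>n \<le> m\<close> by simp
  have le: "?l \<le> ?h" using ne by (meson List.finite_set Min_le Max_in set_empty)
  have cost: "online_cost A xs \<le> \<rho> * (?h - ?l)" by (rule ok[OF len le]) auto
  have "online_cost A xs / opt_cost m xs \<le> \<rho>"
  proof (cases "?h - ?l = 0")
    case True
    then show ?thesis using \<open>0 \<le> \<rho>\<close> by (simp only: opt) simp
  next
    case False
    then show ?thesis using cost le by (simp add: opt divide_le_eq)
  qed
  then show "ereal (online_cost A xs / opt_cost m xs) \<le> ereal \<rho>" by simp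
qed

section \<open>Numbers in a known interval\<close>

text \<open>
  The function \<open>g\<close> fills in the empty cells; since total variation only decreases when values are
  dropped, it bounds the cost of the array and, unlike the cost, is additive over blocks.
\<close>

definition smooth :: "nat \<Rightarrow> real \<Rightarrow> cells \<Rightarrow> bool" where
  "smooth m c a \<longleftrightarrow>
     (\<exists>g. (\<forall>i. g i \<in> {0..1}) \<and> (\<forall>i<m. \<forall>v. a i = Some v \<longrightarrow> g i = v) \<and> var g 0 m \<le> c)"

lemma smooth_nonneg: "smooth m c a \<Longrightarrow> 0 \<le> c"
  unfolding smooth_def using var_nonneg order_trans by blast

text \<open>Cells are numbered from 0 here, so that a block or a chunk is embedded by adding its
  offset; the outer array has the cells \<open>{1..M}\<close>.\<close>

abbreviation sortable :: "nat \<Rightarrow> real \<Rightarrow> nat \<Rightarrow> cells \<Rightarrow> bool" where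
  "sortable m c \<equiv> win (smooth m c) {..<m} {0..1}"

lemma var_le_length:
  assumes "\<And>i. g i \<in> {0..1}"
  shows "var g 0 m \<le> real m"
proof -
  have "var g 0 m \<le> (\<Sum>i=0..<m. 1)"
    unfolding var_def
  proof (rule sum_mono)
    fix i
    show "\<bar>g i - g (Suc i)\<bar> \<le> 1" using assms[of i] assms[of "Suc i"] by auto
  qed
  then show ?thesis by simp
qed

text \<open>Any empty cell will do: an extension with values in \<open>[0,1]\<close> makes
  \<open>m\<close> steps of size at most 1.\<close>

lemma sortable_trivial_aux:
  assumes "dom a \<subseteq> {..<m}" "ran a \<subseteq> {0..1}" "card (dom a) + N \<le> m" "real m \<le> c"
  shows "sortable m c N a"
  using assms(1-3)
proof (induction N arbitrary: a)
  have ok: "smooth m c a" if "ran a \<subseteq> {0..1}" for a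
  proof -
    define g where "g = (\<lambda>i. case a i of None \<Rightarrow> 0 | Some v \<Rightarrow> v)"
    have g: "g i \<in> {0..1}" for i
      using that by (force simp: g_def ran_def split: option.split)
    show ?thesis unfolding smooth_def
      using g var_le_length[of g m] assms(4) by (intro exI[of _ g]) (auto simp: g_def)
  qed
  {
    case 0
    then show ?case using ok by simp
  next
    case (Suc N)
    have "card (dom a) < card {..<m}" using Suc.prems by simp
    then have "dom a \<noteq> {..<m}" by auto
    with Suc.prems(1) obtain p where p: "p < m" "p \<notin> dom a" by auto
    have fin: "finite (dom a)" using Suc.prems(1) finite_subset by blast
    have "sortable m c N (a(p \<mapsto> x))" if "x \<in> {0..1}" for x
    proof (rule Suc.IH)
      show "dom (a(p \<mapsto> x)) \<subseteq> {..<m}" "card (dom (a(p \<mapsto> x))) + N \<le> m"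
        using p Suc.prems fin by auto
      show "ran (a(p \<mapsto> x)) \<subseteq> {0..1}"
        using Suc.prems(2) that p by (auto simp: ran_def)
    qed
    with p ok Suc.prems show ?case by auto
  }
qed

lemma sortable_trivial: "N \<le> m \<Longrightarrow> real m \<le> c \<Longrightarrow> sortable m c N Map.empty"
  by (rule sortable_trivial_aux) auto

section \<open>Composing a game from blocks\<close>

lemma sum_blocks: "(\<Sum>i=0..<K * B. f i) = (\<Sum>b=0..<K. \<Sum>j=0..<B. f (b * B + j))" for f :: "nat \<Rightarrow> real"
proof (induction K)
  case (Suc K)
  have "(\<Sum>i=0..<Suc K * B. f i) = (\<Sum>i=0..<K * B. f i) + (\<Sum>i=K*B..<K*B+B. f i)"
    by (simp add: sum.atLeastLessThan_concat add.commute)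
  also have "(\<Sum>i=K*B..<K*B+B. f i) = (\<Sum>j=0..<B. f (K * B + j))"
    using sum.shift_bounds_nat_ivl[of f 0 "K * B" B] by (simp add: add.commute)
  finally show ?case using Suc by simp
qed simp

text \<open>
  An array of \<open>K\<close> blocks of \<open>B\<close> cells for the numbers in \<open>[0,1]\<close>, which is cut into \<open>d\<close> intervals.
  Block \<open>b\<close> holds numbers from interval \<open>lab b\<close> (if it is in use) and contains \<open>cnt b \<le> N1\<close>
  numbers, arranged as \<open>s b\<close> after rescaling to \<open>[0,1]\<close>. An interval gets a new block only when
  its earlier ones are full. The left end points of the intervals in order of block creation
  form an instance of the problem with \<open>K\<close> cells, of which \<open>R\<close> further steps can be played.
\<close>

locale blocks =
  fixes K B T N1 N d :: nat and c1 c2 c :: real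
  assumes d: "0 < d" "d \<le> T"
    and top: "sortable K c1 T Map.empty"
    and bot: "sortable B c2 N1 Map.empty"
    and room: "N \<le> N1 * (T - d)"
    and cost: "c1 + real K * (c2 + 1) / real d \<le> c"
begin

definition top_array :: "(nat \<rightharpoonup> nat) \<Rightarrow> cells" where
  "top_array lab = (\<lambda>b. map_option (\<lambda>j. real j / real d) (lab b))"

definition block_inv :: "cells \<Rightarrow> (nat \<rightharpoonup> nat) \<Rightarrow> (nat \<Rightarrow> cells) \<Rightarrow> (nat \<Rightarrow> nat) \<Rightarrow> nat \<Rightarrow> bool" where
  "block_inv a lab s cnt k \<longleftrightarrow>
     (\<forall>b o'. o' < B \<longrightarrow> a (b * B + o') = (case lab b of None \<Rightarrow> None
        | Some j \<Rightarrow> map_option (\<lambda>v. (real j + v) / real d) (s b o'))) \<and>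
     dom lab \<subseteq> {..<K} \<and> ran lab \<subseteq> {..<d} \<and>
     (\<exists>R. R + card (dom lab) = T \<and> sortable K c1 R (top_array lab)) \<and>
     (\<forall>b\<in>dom lab. cnt b \<le> N1 \<and> sortable B c2 (N1 - cnt b) (s b)) \<and>
     sum cnt (dom lab) = k \<and>
     (\<forall>b\<in>dom lab. \<forall>b'\<in>dom lab. lab b = lab b' \<longrightarrow> b \<noteq> b' \<longrightarrow> cnt b = N1 \<or> cnt b' = N1)"

text \<open>Inside a block, rescaling shrinks the variation to at most \<open>c2 / d\<close>. Every
  value in block \<open>b\<close> exceeds \<open>gt b\<close> by at most \<open>1 / d\<close>, so
  the step into the next block costs at most \<open>1 / d\<close> more than the corresponding step
  of the top-level extension. Summation over the \<open>K\<close> blocks gives the left side of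
  \<open>cost\<close>.\<close>

lemma block_inv_ok:
  assumes "block_inv a lab s cnt k"
  shows "smooth (K * B) c a"
proof (cases "B = 0")
  case True
  have "0 \<le> c"
  proof -
    have "0 \<le> c1" "0 \<le> c2" using top bot smooth_nonneg win_ok by blast+
    then have "0 \<le> c1 + real K * (c2 + 1) / real d" by simp
    with cost show ?thesis by linarith
  qed
  then show ?thesis unfolding smooth_def using True
    by (intro exI[of _ "\<lambda>_. 0"]) (simp add: var_def)
next
  case False
  then have B: "0 < B" by simp
  from assms obtain R where "sortable K c1 R (top_array lab)" unfolding block_inv_def by blast
  then have "smooth K c1 (top_array lab)" by (rule win_ok)
  then obtain gt where gt: "\<And>i. gt i \<in> {0..1}"
      "\<And>b v. b < K \<Longrightarrow> top_array lab b = Some v \<Longrightarrow> gt b = v" "var gt 0 K \<le> c1"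
    unfolding smooth_def by blast
  have "\<forall>b\<in>dom lab. smooth B c2 (s b)"
    using assms unfolding block_inv_def by (meson win_ok)
  then have "\<forall>b\<in>dom lab. \<exists>g. (\<forall>i. g i \<in> {0..1}) \<and> (\<forall>i<B. \<forall>v. s b i = Some v \<longrightarrow> g i = v) \<and>
      var g 0 B \<le> c2"
    by (simp add: smooth_def)
  then obtain gb where *: "\<forall>b\<in>dom lab. (\<forall>i. gb b i \<in> {0..1}) \<and>
      (\<forall>i<B. \<forall>v. s b i = Some v \<longrightarrow> gb b i = v) \<and> var (gb b) 0 B \<le> c2"
    by (rule bchoice[THEN exE])
  have gb: "gb b i \<in> {0..1}" "i < B \<Longrightarrow> s b i = Some v \<Longrightarrow> gb b i = v" "var (gb b) 0 B \<le> c2"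
    if "b \<in> dom lab" for b i v
    using bspec[OF * that] by simp_all
  have c2: "0 \<le> c2" using bot by (rule smooth_nonneg[OF win_ok])
  define f where "f = (\<lambda>b j. if b \<in> dom lab then (real (the (lab b)) + gb b j) / real d else gt b)"
  define g where "g = (\<lambda>i. f (i div B) (i mod B))"
  have gtlab: "gt b = real j / real d" if "lab b = Some j" for b j
    using assms that gt(2)[of b] unfolding block_inv_def top_array_def by force
  have gf: "g (b * B + j) = f b j" if "j < B" for b j
    using that by (simp add: g_def)
  have near: "gt b \<le> f b j \<and> f b j \<le> gt b + 1 / real d" for b j
  proof (cases "b \<in> dom lab")
    case True
    then obtain l where l: "lab b = Some l" by auto
    have "f b j = gt b + gb b j / real d"
      using True gtlab[OF l] by (simp add: f_def l add_divide_distrib)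
    moreover have "0 \<le> gb b j / real d" "gb b j / real d \<le> 1 / real d"
      using gb(1)[OF True, of j] d(1) by (auto simp: divide_right_mono)
    ultimately show ?thesis by simp
  qed (use d(1) in \<open>simp add: f_def\<close>)
  have inblock: "var (f b) 0 B \<le> c2 / real d" for b
  proof (cases "b \<in> dom lab")
    case True
    have "var (f b) 0 B = var (gb b) 0 B / real d"
      unfolding var_def sum_divide_distrib
      using True by (intro sum.cong) (simp_all add: f_def add_divide_distrib flip: diff_divide_distrib)
    with gb(3)[OF True] show ?thesis by (simp add: divide_right_mono)
  qed (use c2 in \<open>simp add: f_def var_def\<close>)
  have g01: "g i \<in> {0..1}" for i
  proof (cases "i div B \<in> dom lab")
    case True
    then obtain j where j: "lab (i div B) = Some j" by auto
    then have "j < d" using assms by (auto simp: block_inv_def ran_def)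
    moreover have "gb (i div B) (i mod B) \<in> {0..1}" using gb(1) True by blast
    ultimately show ?thesis using j True by (auto simp: g_def f_def divide_le_eq)
  qed (use gt(1) in \<open>simp add: g_def f_def\<close>)
  have ext: "g i = v" if "a i = Some v" for i v
  proof -
    have "i mod B < B" using B by simp
    then have "a (i div B * B + i mod B) = (case lab (i div B) of None \<Rightarrow> None
        | Some j \<Rightarrow> map_option (\<lambda>v. (real j + v) / real d) (s (i div B) (i mod B)))"
      using assms unfolding block_inv_def by blast
    with that obtain j w where j: "lab (i div B) = Some j" "s (i div B) (i mod B) = Some w"
      "v = (real j + w) / real d"
      by (cases "lab (i div B)"; cases "s (i div B) (i mod B)") auto
    have dj: "i div B \<in> dom lab" using j(1) by blast
    have "gb (i div B) (i mod B) = w" using gb(2)[OF dj _ j(2)] B by simp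
    then show ?thesis using j(1,3) dj by (simp add: g_def f_def)
  qed
  have "var g 0 (K * B) = (\<Sum>b=0..<K. \<Sum>j=0..<B. \<bar>g (b * B + j) - g (Suc (b * B + j))\<bar>)"
    unfolding var_def by (rule sum_blocks)
  also have "\<dots> \<le> (\<Sum>b=0..<K. \<bar>gt b - gt (Suc b)\<bar> + (c2 + 1) / real d)"
  proof (rule sum_mono)
    fix b
    obtain B' where B': "B = Suc B'" using B by (cases B) auto
    have "(\<Sum>j=0..<B. \<bar>g (b * B + j) - g (Suc (b * B + j))\<bar>) =
        (\<Sum>j=0..<B'. \<bar>g (b * B + j) - g (Suc (b * B + j))\<bar>) +
        \<bar>g (b * B + B') - g (Suc (b * B + B'))\<bar>"
      by (simp add: B')
    also have "(\<Sum>j=0..<B'. \<bar>g (b * B + j) - g (Suc (b * B + j))\<bar>) = var (f b) 0 B'"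
      unfolding var_def
    proof (rule sum.cong)
      fix j assume "j \<in> {0..<B'}"
      then have "g (b * B + j) = f b j" "g (b * B + Suc j) = f b (Suc j)"
        by (intro gf; simp add: B')+
      then show "\<bar>g (b * B + j) - g (Suc (b * B + j))\<bar> = \<bar>f b j - f b (Suc j)\<bar>"
        by simp
    qed simp
    also have "\<dots> \<le> c2 / real d"
      using inblock[of b] var_mono[of 0 0 B' B "f b"] by (simp add: B')
    also have "\<bar>g (b * B + B') - g (Suc (b * B + B'))\<bar> \<le> \<bar>gt b - gt (Suc b)\<bar> + 1 / real d"
    proof -
      have "Suc (b * B + B') = Suc b * B + 0" by (simp add: B')
      then have "g (Suc (b * B + B')) = f (Suc b) 0" using gf[OF B] by metis
      moreover have "g (b * B + B') = f b B'" by (rule gf) (simp add: B')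
      ultimately show ?thesis using near[of b B'] near[of "Suc b" 0] by linarith
    qed
    finally show "(\<Sum>j=0..<B. \<bar>g (b * B + j) - g (Suc (b * B + j))\<bar>) \<le>
        \<bar>gt b - gt (Suc b)\<bar> + (c2 + 1) / real d"
      by (simp add: add_divide_distrib)
  qed
  also have "\<dots> = var gt 0 K + real K * (c2 + 1) / real d"
    by (simp add: var_def sum.distrib)
  also have "\<dots> \<le> c" using gt(3) cost by linarith
  finally show ?thesis unfolding smooth_def using g01 ext by blast
qed

lemma insert_in_block:
  assumes inv: "block_inv a lab s cnt k" and b: "lab b = Some j" "cnt b < N1" and v: "v \<in> {0..1}"
  shows "\<exists>p<K * B. a p = None \<and>
    (\<exists>s' cnt'. block_inv (a(p \<mapsto> (real j + v) / real d)) lab s' cnt' (Suc k))"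
proof -
  have bd: "b \<in> dom lab" "b < K" using inv b by (auto simp: block_inv_def)
  have "N1 - cnt b = Suc (N1 - Suc (cnt b))" using b by simp
  then have "sortable B c2 (Suc (N1 - Suc (cnt b))) (s b)"
    using inv bd unfolding block_inv_def by metis
  from win_SucE[OF this v] obtain q where q: "q < B" "s b q = None"
    "sortable B c2 (N1 - Suc (cnt b)) ((s b)(q \<mapsto> v))" by blast
  let ?p = "b * B + q"
  have "Suc b * B \<le> K * B" using bd by (intro mult_right_mono) auto
  then have p: "?p < K * B" using q by simp
  have none: "a ?p = None" using inv b q by (simp add: block_inv_def)
  have fin: "finite (dom lab)" using inv by (auto simp: block_inv_def intro: finite_subset)
  have eq: "b' * B + o' = ?p \<longleftrightarrow> b' = b \<and> o' = q" if "o' < B" for b' o'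
  proof
    assume *: "b' * B + o' = ?p"
    then have "(b' * B + o') div B = ?p div B" "(b' * B + o') mod B = ?p mod B" by simp_all
    then show "b' = b \<and> o' = q" using that q by simp
  qed simp
  let ?a = "a(?p \<mapsto> (real j + v) / real d)"
  let ?s = "s(b := (s b)(q \<mapsto> v))" and ?cnt = "cnt(b := Suc (cnt b))"
  have "block_inv ?a lab ?s ?cnt (Suc k)"
    unfolding block_inv_def
  proof (intro conjI)
    show "\<forall>b' o'. o' < B \<longrightarrow> ?a (b' * B + o') = (case lab b' of None \<Rightarrow> None
        | Some j \<Rightarrow> map_option (\<lambda>v. (real j + v) / real d) (?s b' o'))"
    proof (intro allI impI)
      fix b' o' assume o': "o' < B"
      have old: "a (b' * B + o') = (case lab b' of None \<Rightarrow> None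
        | Some j \<Rightarrow> map_option (\<lambda>v. (real j + v) / real d) (s b' o'))"
        using inv o' unfolding block_inv_def by blast
      show "?a (b' * B + o') = (case lab b' of None \<Rightarrow> None
        | Some j \<Rightarrow> map_option (\<lambda>v. (real j + v) / real d) (?s b' o'))"
      proof (cases "b' = b \<and> o' = q")
        case True
        then show ?thesis using b by simp
      next
        case False
        then have "?a (b' * B + o') = a (b' * B + o')" using eq[OF o', of b'] by auto
        then show ?thesis using old False by (auto split: option.split)
      qed
    qed
    show "sum ?cnt (dom lab) = Suc k"
    proof -
      have "sum ?cnt (dom lab) = Suc (cnt b) + sum cnt (dom lab - {b})"
        using sum.remove[OF fin bd(1), of ?cnt] by simp
      moreover have "sum cnt (dom lab) = cnt b + sum cnt (dom lab - {b})"
        using sum.remove[OF fin bd(1), of cnt] by simp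
      ultimately show ?thesis using inv by (simp add: block_inv_def)
    qed
    show "\<forall>b'\<in>dom lab. ?cnt b' \<le> N1 \<and> sortable B c2 (N1 - ?cnt b') (?s b')"
      using inv b q(3) unfolding block_inv_def by auto
    show "\<forall>x\<in>dom lab. \<forall>y\<in>dom lab. lab x = lab y \<longrightarrow> x \<noteq> y \<longrightarrow> ?cnt x = N1 \<or> ?cnt y = N1"
    proof (intro ballI impI)
      fix x y assume xy: "x \<in> dom lab" "y \<in> dom lab" "lab x = lab y" "x \<noteq> y"
      then have "cnt x = N1 \<or> cnt y = N1" using inv unfolding block_inv_def by blast
      then show "?cnt x = N1 \<or> ?cnt y = N1" using b(2) by auto
    qed
  qed (use inv in \<open>simp_all add: block_inv_def\<close>)
  with p none show ?thesis by blast
qed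

text \<open>Blocks that are not full carry distinct labels, so there are at most \<open>d\<close> of
  them. The full ones hold \<open>N1\<close> numbers each, and fewer than
  \<open>N1 * (T - d)\<close> numbers have arrived, so there are fewer than \<open>T - d\<close> of
  them. Hence fewer than \<open>T\<close> blocks are in use and the top-level game has a move
  left.\<close>

lemma open_block:
  assumes inv: "block_inv a lab s cnt k" and j: "j < d" and k: "k < N"
    and full: "\<And>b. lab b = Some j \<Longrightarrow> cnt b = N1"
  shows "\<exists>lab' s' cnt' b. block_inv a lab' s' cnt' k \<and> lab' b = Some j \<and> cnt' b < N1"
proof -
  have fin: "finite (dom lab)" using inv by (auto simp: block_inv_def intro: finite_subset)
  define F where "F = {b \<in> dom lab. cnt b = N1}"
  define G where "G = {b \<in> dom lab. cnt b \<noteq> N1}"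
  have FG: "dom lab = F \<union> G" "F \<inter> G = {}" by (auto simp: F_def G_def)
  have finFG: "finite F" "finite G" using fin FG by auto
  have "card G \<le> card {..<d}"
  proof (rule card_inj_on_le[of "\<lambda>b. the (lab b)"])
    show "inj_on (\<lambda>b. the (lab b)) G"
    proof (rule inj_onI)
      fix x y assume xy: "x \<in> G" "y \<in> G" "the (lab x) = the (lab y)"
      then have "x \<in> dom lab" "y \<in> dom lab" "lab x = lab y" "cnt x \<noteq> N1" "cnt y \<noteq> N1"
        by (auto simp: G_def)
      then show "x = y" using inv unfolding block_inv_def by blast
    qed
    show "(\<lambda>b. the (lab b)) ` G \<subseteq> {..<d}" using inv by (force simp: block_inv_def G_def ran_def)
  qed simp
  then have G: "card G \<le> d" by simp
  have "N1 * card F = sum cnt F" by (simp add: F_def)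
  also have "\<dots> \<le> sum cnt (dom lab)" using fin FG by (intro sum_mono2) auto
  also have "\<dots> = k" using inv by (simp add: block_inv_def)
  finally have "N1 * card F < N1 * (T - d)" using k room by linarith
  then have N1: "0 < N1" and F: "card F < T - d" by auto
  have "card (dom lab) = card F + card G" unfolding FG(1) using FG(2) finFG by (rule_tac card_Un_disjoint)
  with F G have "card (dom lab) < T" by linarith
  with inv obtain R where R: "Suc R + card (dom lab) = T" "sortable K c1 (Suc R) (top_array lab)"
    unfolding block_inv_def by (metis add_cancel_left_left less_irrefl not0_implies_Suc)
  have "real j / real d \<in> {0..1}" using j by (simp add: divide_le_eq)
  from win_SucE[OF R(2) this] obtain b where b: "b < K" "top_array lab b = None"
    "sortable K c1 R ((top_array lab)(b \<mapsto> real j / real d))" by blast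
  then have lb: "lab b = None" by (simp add: top_array_def)
  then have bn: "b \<notin> dom lab" by auto
  let ?lab = "lab(b \<mapsto> j)" and ?s = "s(b := Map.empty)" and ?cnt = "cnt(b := 0)"
  have ta: "top_array ?lab = (top_array lab)(b \<mapsto> real j / real d)"
    by (auto simp: top_array_def)
  have "block_inv a ?lab ?s ?cnt k"
    unfolding block_inv_def
  proof (intro conjI)
    show "\<forall>b' o'. o' < B \<longrightarrow> a (b' * B + o') = (case ?lab b' of None \<Rightarrow> None
        | Some j \<Rightarrow> map_option (\<lambda>v. (real j + v) / real d) (?s b' o'))"
    proof (intro allI impI)
      fix b' o' assume o': "o' < B"
      have old: "a (b' * B + o') = (case lab b' of None \<Rightarrow> None
        | Some j \<Rightarrow> map_option (\<lambda>v. (real j + v) / real d) (s b' o'))"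
        using inv o' unfolding block_inv_def by blast
      show "a (b' * B + o') = (case ?lab b' of None \<Rightarrow> None
        | Some j \<Rightarrow> map_option (\<lambda>v. (real j + v) / real d) (?s b' o'))"
        using old lb by (auto split: option.split)
    qed
    show "dom ?lab \<subseteq> {..<K}" using inv b by (auto simp: block_inv_def)
    show "ran ?lab \<subseteq> {..<d}" using inv j lb by (auto simp: block_inv_def)
    show "\<exists>R. R + card (dom ?lab) = T \<and> sortable K c1 R (top_array ?lab)"
      using R(1) b(3) bn fin ta by (intro exI[of _ R]) auto
    show "\<forall>b'\<in>dom ?lab. ?cnt b' \<le> N1 \<and> sortable B c2 (N1 - ?cnt b') (?s b')"
      using inv bot unfolding block_inv_def by auto
    have "sum ?cnt (dom lab) = sum cnt (dom lab)" using bn by (intro sum.cong) auto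
    then show "sum ?cnt (dom ?lab) = k" using inv fin bn by (simp add: block_inv_def)
    show "\<forall>x\<in>dom ?lab. \<forall>y\<in>dom ?lab. ?lab x = ?lab y \<longrightarrow> x \<noteq> y \<longrightarrow> ?cnt x = N1 \<or> ?cnt y = N1"
      using inv full unfolding block_inv_def by auto
  qed
  then show ?thesis using N1 by (intro exI[of _ ?lab] exI[of _ ?s] exI[of _ ?cnt] exI[of _ b]) simp
qed

lemma block_inv_sortable: "block_inv a lab s cnt k \<Longrightarrow> k + M \<le> N \<Longrightarrow> sortable (K * B) c M a"
proof (induction M arbitrary: a lab s cnt k)
  case 0
  then show ?case using block_inv_ok by simp
next
  case (Suc M)
  have "\<exists>p\<in>{..<K * B}. a p = None \<and> sortable (K * B) c M (a(p \<mapsto> x))" if x: "x \<in> {0..1}" for x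
  proof -
    \<comment> \<open>The minimum matters for \<open>x = 1\<close> only, which goes to the last
      interval with \<open>v = 1\<close>.\<close>
    define j where "j = min (nat \<lfloor>real d * x\<rfloor>) (d - 1)"
    define v where "v = real d * x - real j"
    have j: "j < d" using d(1) by (simp add: j_def)
    have x': "x = (real j + v) / real d" using d(1) by (simp add: v_def)
    have v: "v \<in> {0..1}"
    proof (cases "nat \<lfloor>real d * x\<rfloor> \<le> d - 1")
      case True
      then have "real j = of_int \<lfloor>real d * x\<rfloor>" using x by (simp add: j_def)
      then show ?thesis unfolding v_def by (simp add: le_diff_eq) linarith
    next
      case False
      then have "j = d - 1" by (simp add: j_def)
      moreover have "real d \<le> real d * x" using False x d(1) by linarith
      moreover have "real d * x \<le> real d" using x by (simp add: mult_left_le)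
      ultimately show ?thesis using d(1) by (simp add: v_def of_nat_diff)
    qed
    have "\<exists>lab s cnt b. block_inv a lab s cnt k \<and> lab b = Some j \<and> cnt b < N1"
    proof (cases "\<exists>b. lab b = Some j \<and> cnt b \<noteq> N1")
      case True
      then obtain b where b: "lab b = Some j" "cnt b \<noteq> N1" by blast
      have "cnt b \<le> N1" using Suc.prems(1) b(1) unfolding block_inv_def by blast
      then have "cnt b < N1" using b(2) by simp
      then show ?thesis using Suc.prems(1) b(1) by blast
    next
      case False
      then show ?thesis using open_block[OF Suc.prems(1) j] Suc.prems(2) by auto
    qed
    then obtain lab s cnt b where "block_inv a lab s cnt k" "lab b = Some j" "cnt b < N1" by blast
    from insert_in_block[OF this v] obtain p s' cnt' where p: "p < K * B" "a p = None"
      and inv': "block_inv (a(p \<mapsto> x)) lab s' cnt' (Suc k)"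
      unfolding x' by blast
    have "sortable (K * B) c M (a(p \<mapsto> x))" by (rule Suc.IH[OF inv']) (use Suc.prems(2) in simp)
    with p show ?thesis by blast
  qed
  then show ?case using block_inv_ok[OF Suc.prems(1)] by simp
qed

lemma sortable: "sortable (K * B) c N Map.empty"
proof (rule block_inv_sortable)
  show "block_inv Map.empty Map.empty (\<lambda>_. Map.empty) (\<lambda>_. 0) 0"
    unfolding block_inv_def using top by (simp add: top_array_def)
qed simp

end

section \<open>The recursion over the levels\<close>

lemma smooth_mono:
  assumes "smooth m c a" "m \<le> m'" "c \<le> c'" "dom a \<subseteq> {..<m}"
  shows "smooth m' c' a"
proof -
  from assms(1) obtain g where g: "\<And>i. g i \<in> {0..1}" "\<And>i v. i < m \<Longrightarrow> a i = Some v \<Longrightarrow> g i = v"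
    "var g 0 m \<le> c"
    unfolding smooth_def by blast
  define h where "h = (\<lambda>i. g (min i (m - 1)))"
  have "var h 0 m' = var h 0 (m - 1) + var h (m - 1) m'" using assms(2) by (intro var_split) auto
  also have "var h (m - 1) m' = 0" by (auto simp: var_def h_def intro!: sum.neutral)
  also have "var h 0 (m - 1) = var g 0 (m - 1)" by (rule var_cong) (simp add: h_def)
  also have "\<dots> + 0 \<le> var g 0 m" using var_mono[of 0 0 "m - 1" m g] by simp
  finally have "var h 0 m' \<le> c'" using g(3) assms(3) by linarith
  moreover have "h i = v" if "a i = Some v" for i v
  proof -
    have "i < m" using that assms(4) by blast
    then have "min i (m - 1) = i" by simp
    then show ?thesis using g(2) \<open>i < m\<close> that by (simp add: h_def)
  qed
  ultimately show ?thesis unfolding smooth_def using g(1) by (intro exI[of _ h]) (auto simp: h_def)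
qed

lemma sortable_mono:
  "sortable m c N a \<Longrightarrow> dom a \<subseteq> {..<m} \<Longrightarrow> m \<le> m' \<Longrightarrow> c \<le> c' \<Longrightarrow> sortable m' c' N a"
proof (induction N arbitrary: a)
  case 0
  then show ?case using smooth_mono by simp
next
  case (Suc N)
  have "\<exists>p\<in>{..<m'}. a p = None \<and> sortable m' c' N (a(p \<mapsto> x))" if x: "x \<in> {0..1}" for x
  proof -
    obtain p where p: "p < m" "a p = None" "sortable m c N (a(p \<mapsto> x))"
      using win_SucE[OF Suc.prems(1) x] by blast
    have "sortable m' c' N (a(p \<mapsto> x))"
    proof (rule Suc.IH[OF p(3) _ Suc.prems(3,4)])
      show "dom (a(p \<mapsto> x)) \<subseteq> {..<m}" using p(1) Suc.prems(2) by auto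
    qed
    with p Suc.prems(3) show ?thesis by auto
  qed
  then show ?case using smooth_mono[OF win_ok[OF Suc.prems(1)]] Suc.prems by simp
qed

text \<open>The wasted fraction after \<open>r\<close> levels: the solution of s(r+1) = 2 s(r) + 6/D
  with s(0) = 0.\<close>

definition slack :: "nat \<Rightarrow> nat \<Rightarrow> real" where
  "slack D r = 6 * (2 ^ r - 1) / real D"

text \<open>The solution of b(r+1) = b(r) + D (b(r) + 1) with b(0) = D^2, the cost of an arbitrary
  placement in D^2 cells; each level multiplies b + 1 by D + 1.\<close>

definition bound :: "nat \<Rightarrow> nat \<Rightarrow> real" where
  "bound D r = (real D + 1) ^ r * (real D ^ 2 + 1) - 1"

lemma bound_ge: "real D ^ 2 \<le> bound D r"
proof -
  have "1 * (real D ^ 2 + 1) \<le> (real D + 1) ^ r * (real D ^ 2 + 1)"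
    by (intro mult_right_mono one_le_power) auto
  then show ?thesis by (simp add: bound_def)
qed

text \<open>The arithmetic of splitting \<open>m\<close> cells into \<open>s = \<lfloor>\<surd>m\<rfloor>\<close> blocks of \<open>s\<close> cells.\<close>

lemma room_arith:
  fixes s \<eta> \<delta> :: real
  assumes "0 \<le> \<eta>" "0 < \<delta>" "2 * \<eta> + 6 * \<delta> \<le> 1" "1 / s \<le> \<delta>" "1 \<le> s" "m \<le> s\<^sup>2 + 2 * s"
    and N: "N \<le> (1 - (2 * \<eta> + 6 * \<delta>)) * m"
    and T: "(1 - \<eta>) * s - 1 \<le> T" and d: "d \<le> \<delta> * s + 1"
  shows "N \<le> T * (T - d)" "d \<le> T"
proof -
  \<comment> \<open>Each rounding loss of 1 is now at most \<delta> s. Of the 6\<delta>, one is lost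
    in \<open>T\<close>, three in \<open>T - d\<close> (rounding \<open>T\<close>, the size of
    \<open>d\<close>, rounding \<open>d\<close>), and two pay for the up to 2 s cells beyond
    s^2.\<close>
  have s1: "1 \<le> \<delta> * s" using assms(4,5) by (simp add: divide_le_eq)
  have T': "(1 - \<eta> - \<delta>) * s \<le> T" using T s1 by (simp add: algebra_simps)
  have Td: "(1 - \<eta> - 3 * \<delta>) * s \<le> T - d" using T d s1 by (simp add: algebra_simps)
  have pos: "0 \<le> 1 - \<eta> - \<delta>" "0 \<le> 1 - \<eta> - 3 * \<delta>" using assms by linarith+
  have "0 \<le> (1 - \<eta> - 3 * \<delta>) * s" using pos(2) assms(5) by simp
  then show "d \<le> T" using Td by linarith
  have "N \<le> (1 - (2 * \<eta> + 6 * \<delta>)) * (s\<^sup>2 + 2 * s)"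
    using N assms(3,6) by (smt (verit) mult_left_mono)
  also have "\<dots> \<le> (1 - (2 * \<eta> + 6 * \<delta>)) * (s\<^sup>2 + 2 * (\<delta> * s) * s)"
    using s1 assms(3,5) by (intro mult_left_mono add_left_mono mult_right_mono) auto
  also have "\<dots> = (1 - (2 * \<eta> + 6 * \<delta>)) * (1 + 2 * \<delta>) * s\<^sup>2"
    by (simp add: algebra_simps power2_eq_square)
  also have "\<dots> \<le> ((1 - \<eta> - \<delta>) * (1 - \<eta> - 3 * \<delta>)) * s\<^sup>2"
  proof (rule mult_right_mono)
    have "0 \<le> \<eta>\<^sup>2 + 8 * (\<eta> * \<delta>) + 15 * \<delta>\<^sup>2" using assms by simp
    then show "(1 - (2 * \<eta> + 6 * \<delta>)) * (1 + 2 * \<delta>) \<le> (1 - \<eta> - \<delta>) * (1 - \<eta> - 3 * \<delta>)"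
      by (simp add: algebra_simps power2_eq_square)
  qed simp
  also have "\<dots> = ((1 - \<eta> - \<delta>) * s) * ((1 - \<eta> - 3 * \<delta>) * s)"
    by (simp add: power2_eq_square)
  also have "\<dots> \<le> T * (T - d)"
    using T' Td pos assms(5) by (intro mult_mono) (auto intro: order_trans[OF _ T'])
  finally show "N \<le> T * (T - d)" .
qed

lemma sortable_known_range:
  assumes D: "0 < D"
  shows "m \<le> D ^ (2 ^ Suc r) \<Longrightarrow> slack D r \<le> 1 \<Longrightarrow> real N \<le> (1 - slack D r) * real m \<Longrightarrow>
    sortable m (bound D r) N Map.empty"
proof (induction r arbitrary: m N)
  case 0
  then have "N \<le> m" "m \<le> D ^ 2" by (simp_all add: slack_def)
  moreover from this(2) have "real m \<le> bound D 0"
    using bound_ge[of D 0] by (metis of_nat_le_iff of_nat_power order_trans)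
  ultimately show ?case using sortable_trivial by blast
next
  case (Suc r)
  have slack0: "0 \<le> slack D r" for r by (simp add: slack_def)
  show ?case
  \<comment> \<open>Small arrays are filled arbitrarily on every level; otherwise s \<ge> D, which
    keeps the rounding losses below \<delta> s.\<close>
  proof (cases "m \<le> D ^ 2")
    case True
    have "(1 - slack D (Suc r)) * real m \<le> 1 * real m"
      using slack0[of "Suc r"] by (intro mult_right_mono) auto
    then have "N \<le> m" using Suc.prems(3) by simp
    moreover have "real m \<le> bound D (Suc r)"
      using True bound_ge[of D "Suc r"] by (metis of_nat_le_iff of_nat_power order_trans)
    ultimately show ?thesis by (rule sortable_trivial)
  next
    case False
    define s where "s = floor_sqrt m"
    have s: "s ^ 2 \<le> m" "m \<le> s ^ 2 + 2 * s"
      using floor_sqrt_power2_le[of m] Suc_floor_sqrt_power2_gt[of m]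
      by (auto simp: s_def power2_eq_square)
    have Ds: "D \<le> s"
      unfolding s_def using False by (intro le_floor_sqrtI) simp
    have "s ^ 2 \<le> (D ^ (2 ^ Suc r)) ^ 2"
      using s(1) Suc.prems(1) by (simp flip: power_mult add: mult.commute)
    then have sm: "s \<le> D ^ (2 ^ Suc r)" by (rule power2_le_imp_le) simp
    define \<eta> where "\<eta> = slack D r"
    define \<delta> where "\<delta> = 1 / real D"
    have sl: "slack D (Suc r) = 2 * \<eta> + 6 * \<delta>"
      by (simp add: slack_def \<eta>_def \<delta>_def field_simps flip: add_divide_distrib)
    have \<eta>0: "0 \<le> \<eta>" and \<delta>0: "0 < \<delta>" using slack0 D by (simp_all add: \<eta>_def \<delta>_def)
    have \<eta>1: "\<eta> \<le> 1" using Suc.prems(2) sl \<eta>0 \<delta>0 by linarith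
    define T where "T = nat \<lfloor>(1 - \<eta>) * real s\<rfloor>"
    define d where "d = nat \<lceil>\<delta> * real s\<rceil>"
    have "0 \<le> (1 - \<eta>) * real s" using \<eta>1 by simp
    then have T: "real T \<le> (1 - \<eta>) * real s" "(1 - \<eta>) * real s - 1 \<le> real T"
      unfolding T_def by linarith+
    have "0 \<le> \<delta> * real s" using \<delta>0 by simp
    then have d: "\<delta> * real s \<le> real d" "real d \<le> \<delta> * real s + 1"
      unfolding d_def by linarith+
    have s1: "1 \<le> real s" "1 / real s \<le> \<delta>" using Ds D by (auto simp: \<delta>_def frac_le)
    have ms: "real m \<le> (real s)\<^sup>2 + 2 * real s" using s(2) by (metis of_nat_add of_nat_le_iff of_nat_mult of_nat_numeral of_nat_power)
    note room = room_arith[OF \<eta>0 \<delta>0 _ s1(2,1) ms _ T(2) d(2), of N]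
    have dT: "d \<le> T" using room(2) Suc.prems(2,3) sl by simp
    have "real N \<le> real T * (real T - real d)" using room(1) Suc.prems(2,3) sl by simp
    then have rm: "N \<le> T * (T - d)" using dT by (simp flip: of_nat_diff of_nat_mult)
    have rec: "sortable s (bound D r) T Map.empty"
      using Suc.IH[OF sm] \<eta>1 T(1) by (simp add: \<eta>_def)
    have dpos: "0 < d"
    proof -
      have "0 < \<delta> * real s" using \<delta>0 s1 by simp
      then show ?thesis using d(1) by linarith
    qed
    have "bound D r + real s * (bound D r + 1) / real d \<le> bound D (Suc r)"
    proof -
      have "real s / real d \<le> real D"
        using d(1) dpos D by (simp add: \<delta>_def field_simps)
      moreover have "0 \<le> bound D r" using bound_ge[of D r] by (meson order_trans zero_le_power2)
      ultimately have "real s / real d * (bound D r + 1) \<le> real D * (bound D r + 1)"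
        by (intro mult_right_mono) auto
      moreover have "bound D (Suc r) = bound D r + real D * (bound D r + 1)"
        by (simp add: bound_def algebra_simps)
      ultimately show ?thesis by simp
    qed
    \<comment> \<open>The same game on \<open>s\<close> cells with \<open>T\<close> numbers serves
      both for ordering the blocks and for filling each of them.\<close>
    then interpret blocks s s T T N d "bound D r" "bound D r" "bound D (Suc r)"
      using dpos dT rec rm by unfold_locales
    show ?thesis using sortable s(1) by (auto simp: power2_eq_square intro: sortable_mono)
  qed
qed

section \<open>Numbers of unknown range\<close>

text \<open>
  The array is filled from left to right by chunks, each of which is an instance of the problem
  with known range \<open>[lo, lo + L]\<close>. A phase lasts until a number outside this interval arrives.
  The interval is three times as long as the range of the numbers seen at the start of the phase and
  has it in the middle, so \<open>L\<close> at least doubles from one phase to the next. Within a phase, a chunk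
  has capacity \<open>q\<close> about \<open>1/E\<close> times the number \<open>i\<close> of numbers in the earlier chunks of the phase, so
  that the unused capacity is a small fraction of the used one and there are only \<open>O(E log n)\<close>
  chunks. Moreover, \<open>kd\<close> numbers arrived in earlier phases, \<open>f\<close> are in the current chunk, which
  starts at cell \<open>b\<close> and is the \<open>J\<close>-th one of its phase. The set \<open>Y\<close> is empty except while a
  phase is being opened, when it contains the number that opens it but is not placed yet.
\<close>

locale phases =
  fixes n E Jm M :: nat and sz :: "nat \<Rightarrow> nat" and c \<eta> :: real
  assumes sz: "\<And>q. 1 \<le> q \<Longrightarrow> q \<le> n \<Longrightarrow> sortable (sz q) c q Map.empty"
      "\<And>q. 1 \<le> q \<Longrightarrow> q \<le> n \<Longrightarrow> real (sz q) \<le> (1 + \<eta>) * real q"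
    and E: "1 \<le> E"
    and Jm: "\<And>J. (1 + 1 / (2 * real E)) ^ J \<le> 2 * real n \<Longrightarrow> Suc J \<le> Jm"
    and M: "(1 + \<eta>) * (1 + 1 / real E) * real n < real M + 1"
    and nonneg: "0 \<le> c" "0 \<le> \<eta>"
    and n: "1 \<le> n"
begin

text \<open>Quantifying over all enclosing intervals avoids minima and maxima of a possibly empty
  array. The factor 6 is 3 * 2: \<open>L\<close> is at most three times the length of such an
  interval, and \<open>Jm + J\<close> is at most \<open>2 * Jm\<close>.\<close>

definition good :: "cells \<Rightarrow> bool" where
  "good a \<longleftrightarrow> (\<forall>l h. l \<le> h \<longrightarrow> ran a \<subseteq> {l..h} \<longrightarrow> array_cost a \<le> 6 * (c + 1) * real Jm * (h - l))"

text \<open>\<open>g\<close> describes the cells before \<open>b\<close>, and \<open>s\<close> the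
  current chunk. In the variation bound, \<open>J - 1\<close> counts the closed chunks of the phase,
  and \<open>Jm\<close> pays for all earlier phases: at the end of the previous one the bound is at
  most \<open>2 * Jm * (c + 1)\<close> times its length, and \<open>L\<close> is at least twice that
  length. Both third points of the interval are numbers in the array or in \<open>Y\<close>, so the
  numbers spread over at least \<open>L / 3\<close>.\<close>

definition phase_inv :: "cells \<Rightarrow> real set \<Rightarrow> nat \<Rightarrow> nat \<Rightarrow> nat \<Rightarrow> nat \<Rightarrow> nat \<Rightarrow> nat \<Rightarrow>
    real \<Rightarrow> real \<Rightarrow> cells \<Rightarrow> (nat \<Rightarrow> real) \<Rightarrow> bool" where
  "phase_inv a Y kd i q f J b lo L s g \<longleftrightarrow>
     1 \<le> b \<and> a 0 = None \<and> (\<forall>p\<ge>b + sz q. a p = None) \<and>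
     (\<forall>p<b. \<forall>v. a p = Some v \<longrightarrow> g p = v) \<and> (\<forall>p. g p \<in> {lo..lo + L}) \<and>
     (\<forall>r<sz q. a (b + r) = map_option (\<lambda>v. lo + L * v) (s r)) \<and>
     var g 1 b \<le> (c + 1) * L * (real Jm + real J - 1) \<and>
     f \<le> q \<and> sortable (sz q) c (q - f) s \<and>
     1 \<le> q \<and> q \<le> n \<and> (q = 1 \<or> q * E \<le> i) \<and>
     1 \<le> J \<and> (1 + 1 / (2 * real E)) ^ (J - 1) \<le> real i + real q \<and>
     real (b + sz q) \<le> 1 + (1 + \<eta>) * (real kd * (1 + 1 / real E) + real i + real q) \<and>
     0 \<le> L \<and> lo + L / 3 \<in> ran a \<union> Y \<and> lo + 2 * L / 3 \<in> ran a \<union> Y \<and> ran a \<subseteq> {lo..lo + L}"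

lemma capacity_le:
  assumes "q = 1 \<or> q * E \<le> i" "1 \<le> f"
  shows "real i + real q \<le> (real i + real f) * (1 + 1 / real E)"
proof (cases "q = 1")
  case True
  have "real i + real q \<le> (real i + real f) * 1" using True assms(2) by simp
  also have "\<dots> \<le> (real i + real f) * (1 + 1 / real E)" by (intro mult_left_mono) auto
  finally show ?thesis .
next
  case False
  then have "real (q * E) \<le> real i" using assms(1) by (meson of_nat_le_iff)
  then have "real q \<le> real i / real E" using E by (simp add: le_divide_eq)
  then have "real i + real q \<le> real i * (1 + 1 / real E)" by (simp add: algebra_simps)
  also have "\<dots> \<le> (real i + real f) * (1 + 1 / real E)" by (intro mult_right_mono) auto
  finally show ?thesis .
qed

text \<open>\<open>f'\<close> need not be \<open>f\<close>: a chunk just opened has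
  \<open>f = 0\<close>, while the number about to be placed already counts.\<close>

lemma allocated_le:
  assumes "phase_inv a Y kd i q f J b lo L s g" "1 \<le> f'"
  shows "real (b + sz q) \<le> 1 + (1 + \<eta>) * (1 + 1 / real E) * real (kd + i + f')"
proof -
  have "real i + real q \<le> (real i + real f') * (1 + 1 / real E)"
    using assms unfolding phase_inv_def by (intro capacity_le) auto
  then have "real kd * (1 + 1 / real E) + real i + real q \<le> (1 + 1 / real E) * real (kd + i + f')"
    by (simp add: algebra_simps)
  then have "(1 + \<eta>) * (real kd * (1 + 1 / real E) + real i + real q) \<le>
      (1 + \<eta>) * ((1 + 1 / real E) * real (kd + i + f'))"
    using nonneg by (intro mult_left_mono) auto
  moreover have "real (b + sz q) \<le> 1 + (1 + \<eta>) * (real kd * (1 + 1 / real E) + real i + real q)"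
    using assms(1) unfolding phase_inv_def by blast
  ultimately show ?thesis by (simp add: mult.assoc)
qed

text \<open>The capacity allocated in a phase grows geometrically with the number of chunks, yet
  never exceeds \<open>2 * n\<close>.\<close>

lemma chunks_le:
  assumes inv: "phase_inv a Y kd i q f J b lo L s g" and f: "1 \<le> f" "kd + i + f \<le> n"
  shows "J \<le> Jm"
proof -
  have J: "1 \<le> J" "(1 + 1 / (2 * real E)) ^ (J - 1) \<le> real i + real q"
    using inv unfolding phase_inv_def by blast+
  have "real i + real q \<le> (real i + real f) * (1 + 1 / real E)"
    using inv f(1) unfolding phase_inv_def by (intro capacity_le) auto
  also have "\<dots> \<le> real n * 2"
    using f(2) E by (intro mult_mono) auto
  finally have "Suc (J - 1) \<le> Jm" using J(2) by (intro Jm) simp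
  then show ?thesis using J(1) by simp
qed

text \<open>Appending the current chunk costs \<open>c * L\<close> for its inside and at most
  \<open>L\<close> for the jump into it.\<close>

lemma extend:
  assumes inv: "phase_inv a Y kd i q f J b lo L s g"
  shows "\<exists>g'. (\<forall>p v. a p = Some v \<longrightarrow> g' p = v) \<and> (\<forall>p. g' p \<in> {lo..lo + L}) \<and>
    var g' 1 (b + sz q) \<le> (c + 1) * L * (real Jm + real J)"
proof -
  have b: "1 \<le> b" and L: "0 \<le> L" and out: "\<And>p. b + sz q \<le> p \<Longrightarrow> a p = None"
    and g: "\<And>p v. p < b \<Longrightarrow> a p = Some v \<Longrightarrow> g p = v" "\<And>p. g p \<in> {lo..lo + L}"
      "var g 1 b \<le> (c + 1) * L * (real Jm + real J - 1)"
    and s: "\<And>r. r < sz q \<Longrightarrow> a (b + r) = map_option (\<lambda>v. lo + L * v) (s r)"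
      "sortable (sz q) c (q - f) s"
    using inv unfolding phase_inv_def by blast+
  from win_ok[OF s(2)] obtain gc where gc: "\<And>i. gc i \<in> {0..1}"
      "\<And>i v. i < sz q \<Longrightarrow> s i = Some v \<Longrightarrow> gc i = v" "var gc 0 (sz q) \<le> c"
    unfolding smooth_def by blast
  define h where "h = (\<lambda>p. if p < b then g p else lo + L * gc (p - b))"
  have hL: "h p \<in> {lo..lo + L}" for p
    using g(2)[of p] gc(1)[of "p - b"] L by (auto simp: h_def mult_left_le)
  have ext: "h p = v" if "a p = Some v" for p v
  proof (cases "p < b")
    case True
    then show ?thesis using g(1) that by (simp add: h_def)
  next
    case False
    moreover have "\<not> b + sz q \<le> p" using out[of p] that by auto
    ultimately have p: "p = b + (p - b)" "p - b < sz q" by simp_all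
    then have "map_option (\<lambda>v. lo + L * v) (s (p - b)) = Some v" using s(1)[OF p(2)] that by simp
    then obtain w where "s (p - b) = Some w" "v = lo + L * w" by auto
    then show ?thesis using gc(2)[OF p(2)] False by (simp add: h_def)
  qed
  have "var h 1 (b + sz q) = var h 1 b + var h b (b + sz q)" using b by (intro var_split) auto
  also have "var h b (b + sz q) = (\<Sum>i=0..<sz q. \<bar>h (b + i) - h (Suc (b + i))\<bar>)"
    unfolding var_def using sum.shift_bounds_nat_ivl[of "\<lambda>i. \<bar>h i - h (Suc i)\<bar>" 0 b "sz q"]
    by (simp add: add.commute)
  also have "\<dots> = L * var gc 0 (sz q)"
    unfolding var_def sum_distrib_left
  proof (rule sum.cong)
    fix i
    have "h (b + i) - h (Suc (b + i)) = L * (gc i - gc (Suc i))"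
      by (simp add: h_def Suc_diff_le algebra_simps)
    then show "\<bar>h (b + i) - h (Suc (b + i))\<bar> = L * \<bar>gc i - gc (Suc i)\<bar>"
      using L by (simp add: abs_mult)
  qed simp
  also have "\<dots> \<le> L * c" using gc(3) L by (rule mult_left_mono)
  \<comment> \<open>Only the last step differs, since \<open>h\<close> takes its value at
    \<open>b\<close> from the chunk instead of from \<open>g\<close>.\<close>
  also have "var h 1 b \<le> var g 1 b + L"
  proof (cases "b = 1")
    case True
    then show ?thesis using L by (simp add: var_def)
  next
    case False
    then obtain b' where b': "b = Suc b'" "1 \<le> b'" using b by (cases b) auto
    have "var h 1 b = var h 1 b' + \<bar>h b' - h b\<bar>" using b' by (simp add: var_Suc)
    also have "var h 1 b' = var g 1 b'" using b' by (intro var_cong) (simp add: h_def)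
    also have "\<dots> \<le> var g 1 b" using b' by (simp add: var_Suc)
    also have "\<bar>h b' - h b\<bar> \<le> L" using hL[of b'] hL[of b] by auto
    finally show ?thesis by simp
  qed
  finally have "var h 1 (b + sz q) \<le> (c + 1) * L * (real Jm + real J)"
    using g(3) by (simp add: algebra_simps)
  with ext hL show ?thesis by blast
qed

text \<open>With \<open>Y\<close> empty, both third points are in the array and hence in
  \<open>{l..h}\<close>, which forces \<open>L \<le> 3 * (h - l)\<close>.\<close>

lemma phase_inv_good:
  assumes inv: "phase_inv a {} kd i q f J b lo L s g" and f: "1 \<le> f" "kd + i + f \<le> n"
  shows "good a"
  unfolding good_def
proof (intro allI impI)
  fix l h :: real assume lh: "l \<le> h" and ran: "ran a \<subseteq> {l..h}"
  obtain g' where g': "\<And>p v. a p = Some v \<Longrightarrow> g' p = v"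
    "var g' 1 (b + sz q) \<le> (c + 1) * L * (real Jm + real J)"
    using extend[OF inv] by blast
  have dom: "dom a \<subseteq> {1..<b + sz q}"
  proof
    fix p assume "p \<in> dom a"
    moreover have "a 0 = None" "\<And>p. b + sz q \<le> p \<Longrightarrow> a p = None"
      using inv unfolding phase_inv_def by blast+
    ultimately have "p \<noteq> 0" "\<not> b + sz q \<le> p" by (metis domIff)+
    then show "p \<in> {1..<b + sz q}" by simp
  qed
  have L: "0 \<le> L" and w: "lo + L / 3 \<in> ran a" "lo + 2 * L / 3 \<in> ran a"
    using inv unfolding phase_inv_def by auto
  have Lr: "L \<le> 3 * (h - l)"
  proof -
    have "l \<le> lo + L / 3" "lo + 2 * L / 3 \<le> h" using subsetD[OF ran w(1)] subsetD[OF ran w(2)] by simp_all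
    then show ?thesis by (simp add: field_simps)
  qed
  have J: "real J \<le> real Jm" using chunks_le[OF inv f] by simp
  have "array_cost a \<le> var g' 1 (b + sz q)" using dom g'(1) by (rule array_cost_le_var)
  also have "\<dots> \<le> (c + 1) * L * (real Jm + real J)" by (rule g'(2))
  also have "\<dots> \<le> (c + 1) * (3 * (h - l)) * (real Jm + real Jm)"
    using J Lr L nonneg lh by (intro mult_mono) auto
  finally show "array_cost a \<le> 6 * (c + 1) * real Jm * (h - l)" by (simp add: algebra_simps)
qed

lemma place:
  assumes inv: "phase_inv a Y kd i q f J b lo L s g" and f: "f < q" "kd + i + f < n"
    and x: "x \<in> {lo..lo + L}" and Y: "Y \<subseteq> {x}"
  shows "\<exists>p\<in>{1..M}. a p = None \<and> (\<exists>s'. phase_inv (a(p \<mapsto> x)) {} kd i q (Suc f) J b lo L s' g)"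
proof -
  \<comment> \<open>For \<open>L = 0\<close> the quotient is 0, which is right because then
    \<open>x = lo\<close>.\<close>
  define v where "v = (x - lo) / L"
  have xv: "x = lo + L * v" and v: "v \<in> {0..1}"
    using x by (cases "L = 0"; auto simp: v_def divide_le_eq)+
  have "q - f = Suc (q - Suc f)" using f by simp
  then have "sortable (sz q) c (Suc (q - Suc f)) s" using inv unfolding phase_inv_def by metis
  from win_SucE[OF this v] obtain r where r: "r < sz q" "s r = None"
    "sortable (sz q) c (q - Suc f) (s(r \<mapsto> v))" by blast
  let ?p = "b + r" and ?a = "a(b + r \<mapsto> x)" and ?s = "s(r \<mapsto> v)"
  have s: "\<And>r. r < sz q \<Longrightarrow> a (b + r) = map_option (\<lambda>v. lo + L * v) (s r)" and b: "1 \<le> b"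
    using inv unfolding phase_inv_def by blast+
  have none: "a ?p = None" using s[OF r(1)] r(2) by simp
  \<comment> \<open>With the number being placed counted, the strict inequality in \<open>M\<close>
    yields \<open>b + sz q \<le> M + 1\<close>, so the chunk ends at cell \<open>M\<close> or
    earlier.\<close>
  have "real (b + sz q) \<le> 1 + (1 + \<eta>) * (1 + 1 / real E) * real (kd + i + Suc f)"
    by (rule allocated_le[OF inv]) simp
  also have "\<dots> \<le> 1 + (1 + \<eta>) * (1 + 1 / real E) * real n"
    using f(2) nonneg by (intro add_left_mono mult_left_mono) auto
  also have "\<dots> < 1 + (real M + 1)" using M by simp
  finally have "real (b + sz q) < real (2 + M)" by simp
  then have "b + sz q < 2 + M" by (simp only: of_nat_less_iff)
  then have p: "?p \<in> {1..M}" using r(1) b by simp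
  have ran: "ran ?a = insert x (ran a)" using none by simp
  have "phase_inv ?a {} kd i q (Suc f) J b lo L ?s g"
    unfolding phase_inv_def
  proof (intro conjI)
    show "?a 0 = None" using inv b by (simp add: phase_inv_def)
    show "\<forall>p\<ge>b + sz q. ?a p = None" using inv r(1) by (simp add: phase_inv_def)
    show "\<forall>p<b. \<forall>v. ?a p = Some v \<longrightarrow> g p = v" using inv by (simp add: phase_inv_def)
    show "\<forall>r'<sz q. ?a (b + r') = map_option (\<lambda>v. lo + L * v) (?s r')"
      using s xv by simp
    show "sortable (sz q) c (q - Suc f) ?s" by (rule r(3))
    show "Suc f \<le> q" using f by simp
    show "lo + L / 3 \<in> ran ?a \<union> {}" "lo + 2 * L / 3 \<in> ran ?a \<union> {}"
      using inv Y unfolding ran by (auto simp: phase_inv_def)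
    show "ran ?a \<subseteq> {lo..lo + L}" using inv x unfolding ran by (simp add: phase_inv_def)
  qed (use inv in \<open>simp_all add: phase_inv_def\<close>)
  with p none show ?thesis by blast
qed

lemma new_chunk:
  assumes inv: "phase_inv a {} kd i q q J b lo L s g" and k: "kd + i + q < n"
  shows "\<exists>q' b' g'. phase_inv a {} kd (i + q) q' 0 (Suc J) b' lo L Map.empty g' \<and> 0 < q'"
proof -
  obtain g' where g': "\<And>p v. a p = Some v \<Longrightarrow> g' p = v" "\<And>p. g' p \<in> {lo..lo + L}"
    "var g' 1 (b + sz q) \<le> (c + 1) * L * (real Jm + real J)"
    using extend[OF inv] by blast
  define y where "y = i + q"
  \<comment> \<open>Since \<open>y mod E < E \<le> q' * E\<close>, rounding down loses at most a
    factor 2, so \<open>y + q'\<close> is at least \<open>1 + 1 / (2 * E)\<close> times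
    \<open>y\<close>.\<close>
  define q' where "q' = max 1 (y div E)"
  have q': "1 \<le> q'" "q' \<le> n" "q' = 1 \<or> q' * E \<le> y"
  proof -
    have "y div E \<le> y" "y \<le> n" using k by (simp_all add: y_def)
    then have "y div E \<le> n" by (rule order_trans)
    then show "q' \<le> n" using n by (simp add: q'_def)
    show "q' = 1 \<or> q' * E \<le> y" by (auto simp: q'_def max_def)
  qed (simp add: q'_def)
  have "y = y div E * E + y mod E" by simp
  also have "\<dots> \<le> q' * E + q' * E"
  proof (rule add_mono)
    show "y div E * E \<le> q' * E" by (simp add: q'_def)
    have "y mod E < E" using E by simp
    also have "1 * E \<le> q' * E" using q'(1) by (intro mult_right_mono) auto
    finally show "y mod E \<le> q' * E" by simp
  qed
  finally have "real y \<le> real (q' * E + q' * E)" by (simp only: of_nat_le_iff)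
  then have y2: "real y / (2 * real E) \<le> real q'" using E by (simp add: divide_le_eq algebra_simps)
  have J: "1 \<le> J" "(1 + 1 / (2 * real E)) ^ (J - 1) \<le> real i + real q"
    using inv unfolding phase_inv_def by blast+
  have "(1 + 1 / (2 * real E)) ^ J = (1 + 1 / (2 * real E)) ^ Suc (J - 1)" using J(1) by simp
  also have "\<dots> \<le> (1 + 1 / (2 * real E)) * real y"
    using J(2) by (simp only: power_Suc) (intro mult_left_mono; simp add: y_def)
  also have "\<dots> \<le> real y + real q'" using y2 by (simp add: algebra_simps)
  finally have pw: "(1 + 1 / (2 * real E)) ^ J \<le> real y + real q'" .
  have none: "\<And>p. b + sz q \<le> p \<Longrightarrow> a p = None" using inv unfolding phase_inv_def by blast
  have "phase_inv a {} kd y q' 0 (Suc J) (b + sz q) lo L Map.empty g'"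
    unfolding phase_inv_def
  proof (intro conjI)
    show "sortable (sz q') c (q' - 0) Map.empty" using sz(1) q' by simp
    show "\<forall>r<sz q'. a (b + sz q + r) = map_option (\<lambda>v. lo + L * v) None" by (simp add: none)
    show "\<forall>p\<ge>b + sz q + sz q'. a p = None" by (simp add: none)
    show "(1 + 1 / (2 * real E)) ^ (Suc J - 1) \<le> real y + real q'" using pw by simp
    show "var g' 1 (b + sz q) \<le> (c + 1) * L * (real Jm + real (Suc J) - 1)" using g'(3) by simp
    have "real (b + sz q) \<le> 1 + (1 + \<eta>) * (real kd * (1 + 1 / real E) + real y)"
      using inv unfolding phase_inv_def y_def by (simp add: add.assoc)
    moreover have "real (sz q') \<le> (1 + \<eta>) * real q'" using sz(2) q' by simp
    ultimately show "real (b + sz q + sz q') \<le>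
        1 + (1 + \<eta>) * (real kd * (1 + 1 / real E) + real y + real q')"
      by (simp add: distrib_left)
  qed (use inv q' g' in \<open>auto simp: phase_inv_def\<close>)
  then show ?thesis using q'(1) unfolding y_def by (metis less_le_trans zero_less_one)
qed

lemma new_phase:
  assumes inv: "phase_inv a {} kd i q f J b lo L s g" and f: "1 \<le> f" "kd + i + f \<le> n"
    and x: "x \<notin> {lo..lo + L}"
  shows "\<exists>b' lo' L' g'. phase_inv a {x} (kd + i + f) 0 1 0 1 b' lo' L' Map.empty g' \<and> x \<in> {lo'..lo' + L'}"
proof -
  obtain g' where g': "\<And>p v. a p = Some v \<Longrightarrow> g' p = v" "\<And>p. g' p \<in> {lo..lo + L}"
    "var g' 1 (b + sz q) \<le> (c + 1) * L * (real Jm + real J)"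
    using extend[OF inv] by blast
  have L: "0 \<le> L" and w: "lo + L / 3 \<in> ran a" "lo + 2 * L / 3 \<in> ran a"
    and ran: "ran a \<subseteq> {lo..lo + L}"
    and none: "\<And>p. b + sz q \<le> p \<Longrightarrow> a p = None"
    using inv unfolding phase_inv_def by auto
  \<comment> \<open>The new third points are \<open>x\<close> and the old third point farther from
    it. They are more than \<open>2 * L / 3\<close> apart, so the length at least doubles, and the
    new interval contains the old one.\<close>
  define mn where "mn = (if x < lo then x else lo + L / 3)"
  define mx where "mx = (if x < lo then lo + 2 * L / 3 else x)"
  define lo' where "lo' = mn - (mx - mn)"
  define L' where "L' = 3 * (mx - mn)"
  have L2: "2 * L \<le> L'" using x L by (auto simp: L'_def mn_def mx_def)
  have nest: "lo' \<le> lo" "lo + L \<le> lo' + L'"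
    using x L by (auto simp: lo'_def L'_def mn_def mx_def)
  have x': "x \<in> {lo'..lo' + L'}"
    using x L by (auto simp: lo'_def L'_def mn_def mx_def)
  have m: "lo' + L' / 3 = mn" "lo' + 2 * L' / 3 = mx" by (simp_all add: lo'_def L'_def field_simps)
  have mr: "mn \<in> ran a \<union> {x}" "mx \<in> ran a \<union> {x}" using w by (simp_all add: mn_def mx_def)
  have J: "real J \<le> real Jm" using chunks_le[OF inv f] by simp
  have "phase_inv a {x} (kd + i + f) 0 1 0 1 (b + sz q) lo' L' Map.empty g'"
    unfolding phase_inv_def m
  proof (intro conjI)
    show "sortable (sz 1) c (1 - 0) Map.empty" using sz(1)[of 1] n by (simp del: win.simps)
    show "\<forall>r<sz 1. a (b + sz q + r) = map_option (\<lambda>v. lo' + L' * v) None" by (simp add: none)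
    show "\<forall>p\<ge>b + sz q + sz 1. a p = None" by (simp add: none)
    have "(c + 1) * L * (real Jm + real J) \<le> (c + 1) * L * (2 * real Jm)"
      using J L nonneg by (intro mult_left_mono) auto
    also have "\<dots> = (c + 1) * (2 * L) * real Jm" by simp
    also have "\<dots> \<le> (c + 1) * L' * real Jm"
      using L2 nonneg by (intro mult_right_mono mult_left_mono) auto
    finally show "var g' 1 (b + sz q) \<le> (c + 1) * L' * (real Jm + real 1 - 1)" using g'(3) by simp
    show "\<forall>p. g' p \<in> {lo'..lo' + L'}"
    proof
      fix p
      show "g' p \<in> {lo'..lo' + L'}" using g'(2)[of p] nest by simp
    qed
    show "ran a \<subseteq> {lo'..lo' + L'}" using ran nest by (auto dest!: subsetD)
    have "real (b + sz q) \<le> 1 + (1 + \<eta>) * (1 + 1 / real E) * real (kd + i + f)"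
      by (rule allocated_le[OF inv f(1)])
    moreover have "real (sz 1) \<le> (1 + \<eta>) * real 1" using sz(2) n by blast
    moreover have "(1 + \<eta>) * (k * R + real 0 + real 1) = (1 + \<eta>) * R * k + (1 + \<eta>)" for k R
      by (simp add: algebra_simps)
    ultimately show "real (b + sz q + sz 1) \<le>
        1 + (1 + \<eta>) * (real (kd + i + f) * (1 + 1 / real E) + real 0 + real 1)"
      by simp
    show "0 \<le> L'" using L L2 by linarith
  qed (use inv n g' mr in \<open>auto simp: phase_inv_def\<close>)
  with x' show ?thesis by blast
qed

lemma phase_inv_win:
  "phase_inv a {} kd i q f J b lo L s g \<Longrightarrow> 1 \<le> f \<Longrightarrow> kd + i + f + N \<le> n \<Longrightarrow> win good {1..M} UNIV N a"
proof (induction N arbitrary: a kd i q f J b lo L s g)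
  case 0
  then show ?case using phase_inv_good by simp
next
  case (Suc N)
  have "\<exists>p\<in>{1..M}. a p = None \<and> win good {1..M} UNIV N (a(p \<mapsto> x))" for x
  proof -
    have "\<exists>Y kd' i' q' f' J' b' lo' L' s' g'. phase_inv a Y kd' i' q' f' J' b' lo' L' s' g' \<and>
      f' < q' \<and> kd' + i' + f' = kd + i + f \<and> x \<in> {lo'..lo' + L'} \<and> Y \<subseteq> {x}"
    proof (cases "x \<in> {lo..lo + L}")
      case False
      from new_phase[OF Suc.prems(1,2) _ False] Suc.prems(3)
      obtain b' lo' L' g' where "phase_inv a {x} (kd + i + f) 0 1 0 1 b' lo' L' Map.empty g'"
        "x \<in> {lo'..lo' + L'}" by auto
      then show ?thesis by (metis add.right_neutral order_refl zero_less_one)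
    next
      case True
      show ?thesis
      proof (cases "f < q")
        case 1: True
        then show ?thesis using Suc.prems(1) True by blast
      next
        case False
        then have fq: "f = q" using Suc.prems(1) unfolding phase_inv_def by simp
        from new_chunk[OF Suc.prems(1)[unfolded fq]] Suc.prems(3) fq
        obtain q' b' g' where "phase_inv a {} kd (i + q) q' 0 (Suc J) b' lo L Map.empty g'" "0 < q'"
          by auto
        moreover have "kd + (i + q) + 0 = kd + i + f" using fq by simp
        ultimately show ?thesis using True by blast
      qed
    qed
    then obtain Y kd' i' q' f' J' b' lo' L' s' g' where *: "phase_inv a Y kd' i' q' f' J' b' lo' L' s' g'"
      "f' < q'" "kd' + i' + f' = kd + i + f" "x \<in> {lo'..lo' + L'}" "Y \<subseteq> {x}" by blast
    have "kd' + i' + f' < n" using *(3) Suc.prems(3) by simp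
    from place[OF *(1,2) this *(4,5)] obtain p s'' where p: "p \<in> {1..M}" "a p = None"
      and inv: "phase_inv (a(p \<mapsto> x)) {} kd' i' q' (Suc f') J' b' lo' L' s'' g'" by blast
    have "win good {1..M} UNIV N (a(p \<mapsto> x))"
      by (rule Suc.IH[OF inv]) (use *(3) Suc.prems(3) in auto)
    with p show ?thesis by blast
  qed
  moreover have "good a" using phase_inv_good[OF Suc.prems(1,2)] Suc.prems(3) by simp
  ultimately show ?case by simp
qed

lemma good_win: "win good {1..M} UNIV n Map.empty"
proof -
  obtain N where N: "n = Suc N" using n by (cases n) auto
  have "good Map.empty" using nonneg by (simp add: good_def array_cost_def contents_def)
  moreover have "\<exists>p\<in>{1..M}. Map.empty p = None \<and> win good {1..M} UNIV N (Map.empty(p \<mapsto> x))" for x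
  proof -
    have "real (sz 1) \<le> (1 + \<eta>) * real 1" using sz(2) n by blast
    \<comment> \<open>The first number opens a phase of length 0, which any different number will
      end.\<close>
    then have "phase_inv Map.empty {x} 0 0 1 0 1 1 x 0 Map.empty (\<lambda>_. x)"
      unfolding phase_inv_def using sz(1)[of 1] n by (simp add: var_def del: win.simps)
    from place[OF this, of x] n obtain p s' where p: "p \<in> {1..M}"
      and inv: "phase_inv (Map.empty(p \<mapsto> x)) {} 0 0 1 (Suc 0) 1 1 x 0 s' (\<lambda>_. x)" by auto
    have "win good {1..M} UNIV N (Map.empty(p \<mapsto> x))"
      by (rule phase_inv_win[OF inv]) (use N in auto)
    with p show ?thesis by blast
  qed
  ultimately show ?thesis unfolding N by simp
qed

lemma competitive:
  assumes "n \<le> M"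
  shows "\<exists>A. online_sorting_algorithm n M A \<and> competitive_ratio n M A \<le> ereal (6 * (c + 1) * real Jm)"
proof (intro exI conjI)
  let ?A = "strategy good {1..M} n"
  show "online_sorting_algorithm n M ?A" by (rule online_sorting_algorithm_strategy[OF good_win])
  show "competitive_ratio n M ?A \<le> ereal (6 * (c + 1) * real Jm)"
  proof (rule competitive_ratio_le[OF _ n assms])
    fix xs and l h :: real assume xs: "length xs = n" "l \<le> h" "set xs \<subseteq> {l..h}"
    have "good (array_after ?A xs n)" by (rule ok_strategy[OF good_win xs(1)])
    moreover have "ran (array_after ?A xs n) \<subseteq> {l..h}"
      using ran_array_after[of n xs ?A] xs by auto
    ultimately show "online_cost ?A xs \<le> 6 * (c + 1) * real Jm * (h - l)"
      using xs unfolding good_def online_cost_def by blast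
  qed (use nonneg in simp)
qed

end

section \<open>The competitive ratio\<close>

text \<open>\<open>length\<close> itself is the algorithm that fills the cells in order of arrival;
  it settles the finitely many small \<open>n\<close>.\<close>

lemma trivial_algorithm:
  assumes "1 \<le> n" "n \<le> m"
  shows "\<exists>A. online_sorting_algorithm n m A \<and> competitive_ratio n m A \<le> ereal (real n)"
proof (intro exI conjI)
  have after: "array_after length xs k =
      (\<lambda>i. if i \<in> {1..k} then Some (xs ! (i - 1)) else None)" if "k \<le> length xs" for xs k
    using that by (induction k) (auto simp: fun_eq_iff)
  show "online_sorting_algorithm n m length"
    unfolding online_sorting_algorithm_def using assms by (auto simp: after)
  show "competitive_ratio n m length \<le> ereal (real n)"
  proof (rule competitive_ratio_le[OF _ assms])
    fix xs and l h :: real assume xs: "length xs = n" "l \<le> h" "set xs \<subseteq> {l..h}"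
    define g where "g = (\<lambda>i. if i \<in> {1..n} then xs ! (i - 1) else l)"
    have g: "g i \<in> {l..h}" for i
    proof (cases "i \<in> {1..n}")
      case True
      then have "xs ! (i - 1) \<in> set xs" using xs(1) by (intro nth_mem) auto
      then show ?thesis using True xs(3) by (auto simp: g_def)
    qed (use xs(2) in \<open>simp only: g_def if_False; simp\<close>)
    have "online_cost length xs \<le> var g 1 (Suc n)"
      unfolding online_cost_def
      by (rule array_cost_le_var) (auto simp: after xs(1) g_def split: if_splits)
    also have "\<dots> \<le> (\<Sum>i=1..<Suc n. h - l)"
      unfolding var_def
    proof (rule sum_mono)
      fix i
      show "\<bar>g i - g (Suc i)\<bar> \<le> h - l" using g[of i] g[of "Suc i"] by auto
    qed
    finally show "online_cost length xs \<le> real n * (h - l)" by simp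
  qed simp
qed

section \<open>Choice of the parameters\<close>

lemma ln_2n_le: "2 \<le> n \<Longrightarrow> ln (2 * real n) \<le> 2 * log 2 (real n)"
proof -
  assume n: "2 \<le> n"
  have "log 2 2 \<le> log 2 (real n)" using n by (subst log_le_cancel_iff) auto
  then have l1: "1 \<le> log 2 (real n)" by simp
  have "ln (2 * real n) = ln 2 * (1 + log 2 (real n))"
    using n by (simp add: ln_mult log_def distrib_left)
  also have "\<dots> \<le> 1 * (1 + log 2 (real n))" using l1 ln_2_less_1 by (intro mult_right_mono) auto
  finally show ?thesis using l1 by simp
qed

text \<open>For t = 1 / (2 E) \<le> 1/2, ln (1 + t) \<ge> t - t^2 \<ge> t / 2; taking logarithms
  then gives J / (4 E) \<le> 2 log n.\<close>

lemma exponent_le: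
  assumes E: "1 \<le> E" and n: "2 \<le> n" and J: "(1 + 1 / (2 * real E)) ^ J \<le> 2 * real n"
  shows "real J \<le> 8 * real E * log 2 (real n)"
proof -
  define t where "t = 1 / (2 * real E)"
  have t: "0 < t" "t \<le> 1 / 2" using E by (auto simp: t_def field_simps)
  have "t * t \<le> t * (1 / 2)" using t by (intro mult_left_mono) auto
  then have "t / 2 \<le> t - t\<^sup>2" by (simp add: power2_eq_square)
  also have "\<dots> \<le> ln (1 + t)" using t by (intro ln_one_plus_pos_lower_bound) auto
  finally have ln: "t / 2 \<le> ln (1 + t)" .
  have "real J * (t / 2) \<le> real J * ln (1 + t)" using ln by (intro mult_left_mono) auto
  also have "\<dots> = ln ((1 + t) ^ J)" using t by (simp add: ln_realpow)
  also have "\<dots> \<le> ln (2 * real n)"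
    using J[folded t_def] t n by (subst ln_le_cancel_iff) auto
  also have "\<dots> \<le> 2 * log 2 (real n)" by (rule ln_2n_le[OF n])
  finally show ?thesis using E by (simp add: t_def field_simps)
qed

lemma competitive_ratio_quasi_polylog:
  fixes \<epsilon> :: real
  assumes n: "9 \<le> n" and \<epsilon>: "0 < \<epsilon>" "\<epsilon> \<le> 3"
  defines "X \<equiv> log 2 (real n) / \<epsilon>"
  shows "\<exists>A. online_sorting_algorithm n (array_size n \<epsilon>) A \<and>
    competitive_ratio n (array_size n \<epsilon>) A \<le> ereal ((342 * X) powr (log 2 (log 2 (real n)) + 4))"
proof -
  define l where "l = log 2 (real n)"
  have l3: "3 \<le> l" using n by (simp add: l_def le_log_iff)
  have X: "1 \<le> X" "l = X * \<epsilon>" using l3 \<epsilon> by (simp_all add: X_def l_def[symmetric])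
  \<comment> \<open>As 2^r \<le> 2 l, this makes the slack at most 12 l / (100 X) = 0.12
    \<epsilon>.\<close>
  define D where "D = nat \<lceil>100 * X\<rceil>"
  define E where "E = nat \<lceil>4 / \<epsilon>\<rceil>"
  define r where "r = nat \<lceil>log 2 l\<rceil>"
  define Jm where "Jm = Suc (nat \<lfloor>8 * real E * l\<rfloor>)"
  \<comment> \<open>Up to D^2 numbers need no spare cells. Beyond that, q \<ge> 100 X \<ge> 300 /
    \<epsilon>, so the cell lost by rounding is at most \<epsilon>/300 of q.\<close>
  define sz where "sz = (\<lambda>q::nat. if q \<le> D ^ 2 then q else nat \<lfloor>(1 + \<epsilon> / 4) * real q\<rfloor>)"
  have D: "100 * X \<le> real D" "real D \<le> 100 * X + 1" using X(1) unfolding D_def by linarith+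
  then have Dpos: "2 \<le> D" using X(1) by linarith
  have "0 < 4 / \<epsilon>" using \<epsilon> by simp
  then have E_bd: "4 / \<epsilon> \<le> real E" "real E \<le> 4 / \<epsilon> + 1" unfolding E_def by linarith+
  then have Epos: "1 \<le> E" using \<open>0 < 4 / \<epsilon>\<close> by linarith
  have ll: "0 \<le> log 2 l" using l3 by simp
  then have r: "log 2 l \<le> real r" "real r \<le> log 2 l + 1" unfolding r_def by linarith+
  have "l \<le> 2 powr real r" using r(1) l3 by (simp add: log_le_iff)
  then have lr: "l \<le> 2 ^ r" by (simp add: powr_realpow)
  have "2 powr real r \<le> 2 powr (log 2 l + 1)" using r(2) by simp
  also have "\<dots> = 2 * l" using l3 by (simp add: powr_add)
  finally have rl: "2 ^ r \<le> 2 * l" by (simp add: powr_realpow)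
  have "real n = 2 powr l" using n by (simp add: l_def)
  also have "\<dots> \<le> 2 powr (2 ^ r)" using lr by simp
  also have "\<dots> = real (2 ^ (2 ^ r))" using powr_realpow[of 2 "2 ^ r"] by simp
  finally have "n \<le> 2 ^ (2 ^ r)" by (simp only: of_nat_le_iff)
  also have "\<dots> \<le> D ^ (2 ^ r)" using Dpos by (rule power_mono) simp
  finally have nD: "n \<le> D ^ (2 ^ r)" .
  have "n * n \<le> D ^ (2 ^ r) * D ^ (2 ^ r)" using nD nD by (rule mult_le_mono)
  then have n2: "n * n \<le> D ^ (2 ^ Suc r)" by (simp flip: power_add add: mult_2)
  define \<eta> where "\<eta> = slack D r"
  have \<eta>: "0 \<le> \<eta>" "\<eta> \<le> 12 / 100 * \<epsilon>"
  proof -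
    have "\<eta> \<le> 6 * (2 * l) / real D"
      unfolding \<eta>_def slack_def using rl by (intro divide_right_mono) auto
    also have "\<dots> \<le> 6 * (2 * l) / (100 * X)"
      using D(1) X(1) l3 by (intro divide_left_mono) auto
    also have "\<dots> = 12 / 100 * \<epsilon>" using X by simp
    finally show "\<eta> \<le> 12 / 100 * \<epsilon>" .
  qed (simp add: \<eta>_def slack_def)
  have bound0: "0 \<le> bound D r" using bound_ge[of D r] by (meson order_trans zero_le_power2)
  have sz_le: "real (sz q) \<le> (1 + \<epsilon> / 4) * real q" for q
  proof (cases "q \<le> D ^ 2")
    case True
    have "real q \<le> (1 + \<epsilon> / 4) * real q" using \<epsilon> by (simp add: mult_right_mono distrib_right)
    then show ?thesis using True by (simp add: sz_def)
  next
    case False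
    have "0 \<le> (1 + \<epsilon> / 4) * real q" using \<epsilon> by simp
    then show ?thesis using False unfolding sz_def by simp
  qed
  have sz: "sortable (sz q) (bound D r) q Map.empty" if q: "1 \<le> q" "q \<le> n" for q
  proof (cases "q \<le> D ^ 2")
    case True
    then have "real q \<le> real (D ^ 2)" by (simp only: of_nat_le_iff)
    then have "real q \<le> bound D r" by (metis bound_ge of_nat_power order_trans)
    then show ?thesis using True sortable_trivial[of q q] by (simp add: sz_def)
  next
    case False
    define m where "m = sz q"
    have m: "(1 + \<epsilon> / 4) * real q - 1 \<le> real m" using False unfolding m_def sz_def by simp linarith
    have m2: "real m \<le> (1 + \<epsilon> / 4) * real q" unfolding m_def by (rule sz_le)
    also have "\<dots> \<le> real n * real n"
      using \<epsilon> q n by (intro mult_mono) auto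
    finally have "real m \<le> real (n * n)" by simp
    then have "m \<le> n * n" by (simp only: of_nat_le_iff)
    then have mD: "m \<le> D ^ (2 ^ Suc r)" using n2 by (rule order_trans)
    have "real (D ^ 2) \<le> real q" using False by (simp only: of_nat_le_iff)
    then have "real D * real D \<le> real q" by (simp add: power2_eq_square)
    moreover have "100 * X * 1 \<le> real D * real D"
      using D(1) Dpos X(1) by (intro mult_mono) auto
    ultimately have "100 * X \<le> real q" by simp
    moreover have "300 / \<epsilon> \<le> 100 * X"
    proof -
      have "100 * X = 100 * l / \<epsilon>" by (simp add: X_def l_def)
      moreover have "300 / \<epsilon> \<le> 100 * l / \<epsilon>" using l3 \<epsilon> by (intro divide_right_mono) auto
      ultimately show ?thesis by simp
    qed
    ultimately have "300 / \<epsilon> \<le> real q" by simp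
    then have q1: "1 \<le> \<epsilon> / 300 * real q" using \<epsilon> by (simp add: field_simps)
    have "real q = (1 + 0) * real q" by simp
    also have "\<dots> \<le> ((1 - 12 / 100 * \<epsilon>) * (1 + \<epsilon> / 4 - \<epsilon> / 300)) * real q"
    proof (rule mult_right_mono)
      have "\<epsilon> * \<epsilon> \<le> \<epsilon> * 3" using \<epsilon> by (intro mult_left_mono) auto
      then show "1 + 0 \<le> (1 - 12 / 100 * \<epsilon>) * (1 + \<epsilon> / 4 - \<epsilon> / 300)" using \<epsilon>
        by (simp add: algebra_simps)
    qed simp
    also have "\<dots> = (1 - 12 / 100 * \<epsilon>) * ((1 + \<epsilon> / 4 - \<epsilon> / 300) * real q)"
      by (rule mult.assoc)
    also have "\<dots> \<le> (1 - \<eta>) * real m"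
    proof (rule mult_mono)
      show "(1 + \<epsilon> / 4 - \<epsilon> / 300) * real q \<le> real m" using m q1 by (simp add: algebra_simps)
    qed (use \<eta> \<epsilon> in auto)
    finally have "real q \<le> (1 - slack D r) * real m" by (simp add: \<eta>_def)
    moreover have "slack D r \<le> 1" using \<eta>(2) \<epsilon> by (simp add: \<eta>_def)
    ultimately show ?thesis
      using sortable_known_range[OF _ mD] Dpos unfolding m_def by simp
  qed
  have Msize: "real (array_size n \<epsilon>) \<le> (1 + \<epsilon>) * real n" "(1 + \<epsilon>) * real n < real (array_size n \<epsilon>) + 1"
  proof -
    have "0 \<le> (1 + \<epsilon>) * real n" using \<epsilon> by simp
    then show "real (array_size n \<epsilon>) \<le> (1 + \<epsilon>) * real n"
      "(1 + \<epsilon>) * real n < real (array_size n \<epsilon>) + 1"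
      unfolding array_size_def by linarith+
  qed
  have nM: "n \<le> array_size n \<epsilon>"
  proof -
    have "real n < real (array_size n \<epsilon>) + 1" using Msize(2) \<epsilon> n by (smt (verit) mult_right_mono mult_cancel_right1 of_nat_0_le_iff)
    then show ?thesis by linarith
  qed
  interpret phases n E Jm "array_size n \<epsilon>" sz "bound D r" "\<epsilon> / 4"
  proof
    show "Suc J \<le> Jm" if "(1 + 1 / (2 * real E)) ^ J \<le> 2 * real n" for J
    proof -
      have "real J \<le> 8 * real E * l" using exponent_le[OF Epos _ that] n by (simp add: l_def)
      then show ?thesis unfolding Jm_def by (simp add: le_nat_floor)
    qed
    have "1 / real E \<le> \<epsilon> / 4" using E_bd(1) \<epsilon> Epos by (simp add: field_simps)
    then have "(1 + \<epsilon> / 4) * (1 + 1 / real E) \<le> (1 + \<epsilon> / 4) * (1 + \<epsilon> / 4)"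
      using \<epsilon> by (intro mult_left_mono) auto
    also have "\<dots> \<le> 1 + \<epsilon>"
    proof -
      have "\<epsilon> * \<epsilon> \<le> \<epsilon> * 3" using \<epsilon> by (intro mult_left_mono) auto
      moreover have "(1 + \<epsilon> / 4) * (1 + \<epsilon> / 4) = 1 + \<epsilon> / 2 + \<epsilon> * \<epsilon> / 16"
        by (simp add: algebra_simps)
      ultimately show ?thesis using \<epsilon> by linarith
    qed
    finally have "(1 + \<epsilon> / 4) * (1 + 1 / real E) * real n \<le> (1 + \<epsilon>) * real n"
      by (rule mult_right_mono) simp
    also note Msize(2)
    finally show "(1 + \<epsilon> / 4) * (1 + 1 / real E) * real n < real (array_size n \<epsilon>) + 1" .
  qed (use sz sz_le Epos bound0 \<epsilon> n in auto)
  \<comment> \<open>342 is 6 * 57, from Jm \<le> 57 X, and it also covers D + 1. The exponent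
    collects r levels, two factors for D^2 + 1 and one for 6 Jm; rounding up r adds the last
    1.\<close>
  have "6 * (bound D r + 1) * real Jm \<le> (342 * X) powr (log 2 l + 4)"
  proof -
    have "4 / \<epsilon> + 1 \<le> 7 / \<epsilon>" using \<epsilon> by (simp add: field_simps)
    then have "real E \<le> 7 / \<epsilon>" using E_bd(2) by linarith
    then have "8 * real E * l \<le> 8 * (7 / \<epsilon>) * l" using l3 by (intro mult_right_mono mult_left_mono) auto
    also have "\<dots> = 56 * X" using \<epsilon> X(2) by simp
    finally have "8 * real E * l \<le> 56 * X" .
    moreover have "real Jm \<le> 8 * real E * l + 1" using l3 unfolding Jm_def by simp
    ultimately have Jm: "real Jm \<le> 57 * X" using X(1) by linarith
    have D1: "real D + 1 \<le> 342 * X" using D(2) X(1) by linarith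
    have "real D ^ 2 + 1 \<le> (real D + 1) ^ 2" by (simp add: power2_sum)
    also have "\<dots> \<le> (342 * X) ^ 2" using D1 by (intro power_mono) auto
    finally have "real D ^ 2 + 1 \<le> (342 * X) ^ 2" .
    moreover have "(real D + 1) ^ r \<le> (342 * X) ^ r" using D1 by (intro power_mono) auto
    ultimately have b: "bound D r + 1 \<le> (342 * X) ^ r * (342 * X) ^ 2"
      unfolding bound_def using X(1) by (simp, intro mult_mono) auto
    have "6 * (bound D r + 1) * real Jm = (bound D r + 1) * (6 * real Jm)" by simp
    also have "\<dots> \<le> ((342 * X) ^ r * (342 * X) ^ 2) * (342 * X)"
      by (rule mult_mono[OF b]) (use Jm X(1) in auto)
    also have "\<dots> = (342 * X) ^ (r + 3)" by (simp add: power_add power3_eq_cube power2_eq_square)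
    also have "\<dots> = (342 * X) powr real (r + 3)" using X(1) by (intro powr_realpow[symmetric]) simp
    also have "\<dots> \<le> (342 * X) powr (log 2 l + 4)" using r(2) X(1) by (intro powr_mono) auto
    finally show ?thesis .
  qed
  then have "ereal (6 * (bound D r + 1) * real Jm) \<le> ereal ((342 * X) powr (log 2 l + 4))" by simp
  with competitive[OF nM] show ?thesis unfolding l_def by (meson order_trans)
qed

theorem theorem1:
  "\<exists>C::real. C > 0 \<and>
     (\<forall>n::nat. \<forall>\<epsilon>::real. 1 \<le> n \<and> 0 < \<epsilon> \<and> \<epsilon> \<le> 3 \<longrightarrow>
       (\<exists>A. online_sorting_algorithm n (array_size n \<epsilon>) A \<and>
            competitive_ratio n (array_size n \<epsilon>) A \<le>
              ereal (if n \<ge> 9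
                     then (inverse \<epsilon> * log 2 (real n)) powr (C * log 2 (log 2 (real n)))
                     else C)))"
proof -
  \<comment> \<open>The least possible value of X, attained at n = 9 and \<epsilon> = 3. As it
    exceeds 1, a fixed power of X absorbs the constant 342.\<close>
  define \<beta> :: real where "\<beta> = log 2 9 / 3"
  have \<beta>: "1 < \<beta>" by (simp add: \<beta>_def less_log_iff)
  define \<kappa> where "\<kappa> = log \<beta> 342"
  have \<kappa>: "0 < \<kappa>" "\<beta> powr \<kappa> = 342" using \<beta> by (simp_all add: \<kappa>_def)
  \<comment> \<open>8 covers n \<le> 8, and the factor 4 comes from log l + 4 \<le> 4 log l, valid
    since l \<ge> 3.\<close>
  define C where "C = 8 + 4 * (\<kappa> + 1)"
  show ?thesis
  proof (rule exI[of _ C], intro conjI allI impI)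
    show "0 < C" using \<kappa> by (simp add: C_def)
    fix n :: nat and \<epsilon> :: real assume a: "1 \<le> n \<and> 0 < \<epsilon> \<and> \<epsilon> \<le> 3"
    let ?b = "if n \<ge> 9 then (inverse \<epsilon> * log 2 (real n)) powr (C * log 2 (log 2 (real n))) else C"
    have "\<exists>B. B \<le> ?b \<and> (\<exists>A. online_sorting_algorithm n (array_size n \<epsilon>) A \<and>
      competitive_ratio n (array_size n \<epsilon>) A \<le> ereal B)"
    proof (cases "9 \<le> n")
      case True
      define l where "l = log 2 (real n)"
      define X where "X = l / \<epsilon>"
      have "log 2 9 \<le> l" using True unfolding l_def by (subst log_le_cancel_iff) auto
      then have l\<beta>: "3 * \<beta> \<le> l" by (simp add: \<beta>_def)
      then have l3: "3 \<le> l" using \<beta> by linarith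
      have "\<beta> * \<epsilon> \<le> \<beta> * 3" using a \<beta> by (intro mult_left_mono) auto
      then have X: "\<beta> \<le> X" using a l\<beta> by (simp add: X_def le_divide_eq)
      have "4 \<le> log 2 (3 ^ 3)" by (simp add: le_log_iff)
      also have "\<dots> = 3 * log 2 3" by (simp only: log_nat_power of_nat_numeral)
      also have "\<dots> \<le> 3 * log 2 l" using l3 by simp
      finally have ll: "4 \<le> 3 * log 2 l" .
      have "342 \<le> X powr \<kappa>" using X \<beta> \<kappa> powr_mono2[of \<kappa> \<beta> X] by simp
      then have "342 * X \<le> X powr \<kappa> * X" using X \<beta> by (intro mult_right_mono) auto
      also have "\<dots> = X powr (\<kappa> + 1)" using X \<beta> by (simp add: powr_add)
      finally have "(342 * X) powr (log 2 l + 4) \<le> (X powr (\<kappa> + 1)) powr (log 2 l + 4)"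
        using X \<beta> ll by (intro powr_mono2) auto
      also have "\<dots> = X powr ((\<kappa> + 1) * (log 2 l + 4))" by (simp add: powr_powr)
      also have "\<dots> \<le> X powr (C * log 2 l)"
      proof (rule powr_mono)
        have "(\<kappa> + 1) * (log 2 l + 4) \<le> (\<kappa> + 1) * (4 * log 2 l)"
          using ll \<kappa> by (intro mult_left_mono) auto
        also have "\<dots> \<le> C * log 2 l" using ll by (simp add: C_def algebra_simps)
        finally show "(\<kappa> + 1) * (log 2 l + 4) \<le> C * log 2 l" .
      qed (use X \<beta> in auto)
      finally have "(342 * X) powr (log 2 l + 4) \<le> ?b"
        using True by (simp add: X_def l_def divide_inverse mult.commute)
      moreover have "\<exists>A. online_sorting_algorithm n (array_size n \<epsilon>) A \<and>
          competitive_ratio n (array_size n \<epsilon>) A \<le> ereal ((342 * X) powr (log 2 l + 4))"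
        using competitive_ratio_quasi_polylog[OF True, of \<epsilon>] a by (simp add: X_def l_def)
      ultimately show ?thesis by blast
    next
      case False
      have "1 * real n \<le> (1 + \<epsilon>) * real n" using a by (intro mult_right_mono) auto
      then have "n \<le> array_size n \<epsilon>" unfolding array_size_def by (simp add: le_nat_floor)
      moreover have "real n \<le> ?b" using False \<kappa> by (simp add: C_def)
      ultimately show ?thesis using trivial_algorithm a by blast
    qed
    then show "\<exists>A. online_sorting_algorithm n (array_size n \<epsilon>) A \<and>
      competitive_ratio n (array_size n \<epsilon>) A \<le> ereal ?b"
      by (meson ereal_less_eq(3) order_trans)
  qed
qed

end
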